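(* Let $z=(z_0,\dots,z_n)$ satisfy the model with $m^\star$ change-points $$z_i-\mu_k^\star=\rho^\star(z_{i-1}-\mu_k^\star)+\epsilon_i,\qquad t_{n,k}^\star+1\le i\le t_{n,k+1}^\star,\ 0\le k\le m^\star,$$ with the assumptions given in the context, and let $(\overline\rho_n)$ be a sequence of real-valued random variables with $\overline\rho_n-\rho^\star=O_P(n^{-1/2})$. Let $(\Delta_n)$ be a real sequence with $n^{-1}\Delta_n\to0$ and $n^{-\alpha}\Delta_n\to+\infty$ for some $\alpha>0$. Let $m_{\max}\ge m^\star$ be a fixed integer and $(\beta_n)_{n\ge1}$ a sequence of positive real numbers such that, as $n\to\infty$, $$\beta_n\to0,\qquad n^{1/2}\beta_n\to+\infty,\qquad \Delta_n\beta_n\to+\infty.$$ Define $$\widehat m=\operatorname*{arg\,min}_{0\le m\le m_{\max}}\Big\{\frac1n SS_m(z,\overline\rho_n)+\beta_n m\Big\}.$$ Then $\widehat m$ converges in probability to $m^\star$. This holds when the $\epsilon_i$ are i.i.d. zero-mean Gaussian, and still holds if the $\epsilon_i$ are only assumed to be independent, centered and with finite second-order moment (common variance $\sigma^{\star2}$).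
   Context: Parameters. $m^\star\ge0$ is the true number of change-points; $0=\tau_0^\star<\tau_1^\star<\dots<\tau_{m^\star+1}^\star=1$, $t_{n,k}^\star=\lfloor n\tau_k^\star\rfloor$; $\mu_0^\star,\dots,\mu_{m^\star}^\star\in\mathbb{R}$ with $\mu_k^\star\ne\mu_{k-1}^\star$ for $1\le k\le m^\star$; $|\rho^\star|<1$; $\sigma^\star>0$. These do not depend on $n$. Noise. $(\epsilon_i)_{i\ge1}$ are zero-mean with variance $\sigma^{\star2}$; $z_0$ is independent of $(\epsilon_i)_{i\ge1}$, with mean $\mu_0^\star$ and variance $\sigma^{\star2}/(1-\rho^{\star2})$, with law not depending on $n$. In the Gaussian case $z_0$ and the $\epsilon_i$ are Gaussian. Admissible segmentations: for each $m$, $\mathcal{A}_{n,m}=\{(t_0,\dots,t_{m+1}) \text{ integers}: t_0=0<t_1<\dots<t_{m+1}=n,\ t_k-t_{k-1}\ge\Delta_n\ \forall k=1,\dots,m+1\}$. Criterion: for $x=(x_0,\dots,x_n)$ and $\rho\in\mathbb{R}$, $$SS_m(x,\rho)=\min_{\boldsymbol\delta\in\mathbb{R}^{m+1},\,\boldsymbol t\in\mathcal A_{n,m}}\ \sum_{k=0}^m\sum_{i=t_k+1}^{t_{k+1}}(x_i-\rho x_{i-1}-\delta_k)^2,$$ defined for $n$ large enough that $\mathcal A_{n,m}\neq\emptyset$ for all $m\le m_{\max}$. *)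

theory Defs
  imports "HOL-Probability.Probability"
begin

definition bounded_in_prob :: "'a measure \<Rightarrow> (nat \<Rightarrow> 'a \<Rightarrow> real) \<Rightarrow> (nat \<Rightarrow> real) \<Rightarrow> bool" where
  "bounded_in_prob M X a \<longleftrightarrow>
     (\<forall>e>0. \<exists>C. \<forall>\<^sub>F n in sequentially. measure M {\<omega> \<in> space M. \<bar>X n \<omega>\<bar> > C * a n} < e)"

definition tendsto_in_prob ::
    "'a measure \<Rightarrow> (nat \<Rightarrow> 'a \<Rightarrow> real) \<Rightarrow> real \<Rightarrow> bool" where
  "tendsto_in_prob M X l \<longleftrightarrow>
     (\<forall>e>0. (\<lambda>n. measure M {\<omega> \<in> space M. \<bar>X n \<omega> - l\<bar> > e}) \<longlonglongrightarrow> 0)"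

definition change_point :: "(nat \<Rightarrow> real) \<Rightarrow> nat \<Rightarrow> nat \<Rightarrow> nat" where
  "change_point \<tau> n k = nat \<lfloor>real n * \<tau> k\<rfloor>"

definition ar1_change_model ::
    "'a measure \<Rightarrow> nat \<Rightarrow> (nat \<Rightarrow> real) \<Rightarrow> (nat \<Rightarrow> real) \<Rightarrow> real \<Rightarrow> (nat \<Rightarrow> 'a \<Rightarrow> real) \<Rightarrow>
     nat \<Rightarrow> (nat \<Rightarrow> 'a \<Rightarrow> real) \<Rightarrow> bool" where
  "ar1_change_model M m \<tau> \<mu> \<rho> \<epsilon> n z \<longleftrightarrow>
     (\<forall>k\<le>m. \<forall>i\<in>{change_point \<tau> n k + 1..change_point \<tau> n (k + 1)}. \<forall>\<omega>\<in>space M.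
        z i \<omega> - \<mu> k = \<rho> * (z (i - 1) \<omega> - \<mu> k) + \<epsilon> i \<omega>)"

text \<open>The initial value \<open>z0 n\<close> may be a different random variable for each sample size \<open>n\<close>;
  only its law is the same for all \<open>n\<close>. Independence of \<open>z0 n\<close> and the whole sequence
  \<open>\<epsilon>\<close> is stated for the generated sigma-algebras, because \<^const>\<open>prob_space.indep_var\<close>
  requires both variables to have values in the same type.\<close>

definition second_order_noise ::
    "'a measure \<Rightarrow> (nat \<Rightarrow> 'a \<Rightarrow> real) \<Rightarrow> (nat \<Rightarrow> 'a \<Rightarrow> real) \<Rightarrow> real \<Rightarrow> real \<Rightarrow> real \<Rightarrow> bool" where
  "second_order_noise M \<epsilon> z0 \<mu>0 \<rho> \<sigma> \<longleftrightarrow>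
     prob_space.indep_vars M (\<lambda>_. borel) \<epsilon> {1..} \<and>
     (\<forall>i\<ge>1. \<epsilon> i \<in> borel_measurable M \<and> integrable M (\<lambda>\<omega>. (\<epsilon> i \<omega>)\<^sup>2) \<and>
        prob_space.expectation M (\<epsilon> i) = 0 \<and> prob_space.variance M (\<epsilon> i) = \<sigma>\<^sup>2) \<and>
     (\<forall>n\<ge>1. z0 n \<in> borel_measurable M \<and> integrable M (\<lambda>\<omega>. (z0 n \<omega>)\<^sup>2) \<and>
        prob_space.expectation M (z0 n) = \<mu>0 \<and>
        prob_space.variance M (z0 n) = \<sigma>\<^sup>2 / (1 - \<rho>\<^sup>2) \<and>
        prob_space.indep_set M (sets (vimage_algebra (space M) (z0 n) borel))
          (sets (vimage_algebra (space M) (\<lambda>\<omega>. \<lambda>i\<in>{1..}. \<epsilon> i \<omega>) (Pi\<^sub>M {1..} (\<lambda>_. borel))))) \<and>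
     (\<forall>n\<ge>1. \<forall>n'\<ge>1. distr M borel (z0 n) = distr M borel (z0 n'))"

definition gaussian_noise ::
    "'a measure \<Rightarrow> (nat \<Rightarrow> 'a \<Rightarrow> real) \<Rightarrow> (nat \<Rightarrow> 'a \<Rightarrow> real) \<Rightarrow> real \<Rightarrow> real \<Rightarrow> real \<Rightarrow> bool" where
  "gaussian_noise M \<epsilon> z0 \<mu>0 \<rho> \<sigma> \<longleftrightarrow>
     second_order_noise M \<epsilon> z0 \<mu>0 \<rho> \<sigma> \<and>
     (\<forall>i\<ge>1. distributed M lborel (\<epsilon> i) (normal_density 0 \<sigma>)) \<and>
     (\<forall>n\<ge>1. distributed M lborel (z0 n) (normal_density \<mu>0 (\<sigma> / sqrt (1 - \<rho>\<^sup>2))))"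

text \<open>A tuple \<open>(t\<^sub>0, \<dots>, t\<^sub>m\<^sub>+\<^sub>1)\<close> is represented by a function on the naturals whose values
  beyond \<open>m + 1\<close> are irrelevant, and similarly for the vector \<open>\<delta>\<close> in \<open>SS\<close>.\<close>

definition admissible :: "(nat \<Rightarrow> real) \<Rightarrow> nat \<Rightarrow> nat \<Rightarrow> (nat \<Rightarrow> nat) set" where
  "admissible \<Delta> n m =
     {t. t 0 = 0 \<and> t (m + 1) = n \<and>
         (\<forall>k\<in>{1..m + 1}. t (k - 1) < t k \<and> real (t k) - real (t (k - 1)) \<ge> \<Delta> n)}"

definition rss :: "nat \<Rightarrow> (nat \<Rightarrow> real) \<Rightarrow> real \<Rightarrow> (nat \<Rightarrow> nat) \<Rightarrow> (nat \<Rightarrow> real) \<Rightarrow> real" where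
  "rss m x \<rho> t \<delta> = (\<Sum>k=0..m. \<Sum>i=t k + 1..t (k + 1). (x i - \<rho> * x (i - 1) - \<delta> k)\<^sup>2)"

text \<open>When \<open>admissible \<Delta> n m\<close> is nonempty, the infimum is a minimum, see \<open>SS_attained\<close> below;
  otherwise the value of \<open>SS\<close> is unspecified.\<close>

definition SS :: "(nat \<Rightarrow> real) \<Rightarrow> nat \<Rightarrow> nat \<Rightarrow> (nat \<Rightarrow> real) \<Rightarrow> real \<Rightarrow> real" where
  "SS \<Delta> n m x \<rho> = Inf {rss m x \<rho> t \<delta> | t \<delta>. t \<in> admissible \<Delta> n m}"

lemma mean_minimises_sum_squares:
  fixes y :: "nat \<Rightarrow> real"
  shows "(\<Sum>i\<in>I. (y i - (\<Sum>i\<in>I. y i) / card I)\<^sup>2) \<le> (\<Sum>i\<in>I. (y i - c)\<^sup>2)"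
proof (cases "card I = 0")
  case True
  then show ?thesis by (cases "finite I") auto
next
  case False
  define a where "a = (\<Sum>i\<in>I. y i) / card I"
  have s: "(\<Sum>i\<in>I. y i) = card I * a" using False by (simp add: a_def)
  have "(\<Sum>i\<in>I. (y i - c)\<^sup>2) = (\<Sum>i\<in>I. (y i - a)\<^sup>2 + (2 * (a - c) * y i + (c\<^sup>2 - a\<^sup>2)))"
    by (rule sum.cong) (auto simp: power2_eq_square algebra_simps)
  also have "\<dots> = (\<Sum>i\<in>I. (y i - a)\<^sup>2) + (2 * (a - c) * (card I * a) + card I * (c\<^sup>2 - a\<^sup>2))"
    by (simp only: sum.distrib sum_distrib_left [symmetric] s) simp
  also have "\<dots> = (\<Sum>i\<in>I. (y i - a)\<^sup>2) + card I * (a - c)\<^sup>2"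
    by (simp add: power2_eq_square algebra_simps)
  finally show ?thesis by (simp add: a_def)
qed

lemma SS_attained:
  assumes "admissible \<Delta> n m \<noteq> {}"
  obtains t \<delta> where "t \<in> admissible \<Delta> n m" "SS \<Delta> n m x \<rho> = rss m x \<rho> t \<delta>"
    "\<And>t' \<delta>'. t' \<in> admissible \<Delta> n m \<Longrightarrow> rss m x \<rho> t \<delta> \<le> rss m x \<rho> t' \<delta>'"
proof -
  define d where "d t k = (\<Sum>i=t k + 1..t (k + 1). x i - \<rho> * x (i - 1)) /
      card {t k + 1..t (k + 1)}" for t :: "nat \<Rightarrow> nat" and k
  have min_d: "rss m x \<rho> t (d t) \<le> rss m x \<rho> t \<delta>" for t \<delta>
    unfolding rss_def d_def by (intro sum_mono mean_minimises_sum_squares)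
  define F where "F t = rss m x \<rho> t (d t)" for t
  have F_restrict: "F (restrict t {..m + 1}) = F t" for t
    unfolding F_def rss_def d_def by (intro sum.cong refl) auto
  have le_n: "t k \<le> n" if "t \<in> admissible \<Delta> n m" "k \<le> m + 1" for t k
    using that(2)
  proof (induction rule: inc_induct)
    case base
    then show ?case using that(1) by (simp add: admissible_def)
  next
    case (step j)
    then have "t (Suc j - 1) < t (Suc j)"
      using that(1) unfolding admissible_def by fastforce
    then show ?case using step by simp
  qed
  have "F ` admissible \<Delta> n m \<subseteq> F ` ({..m + 1} \<rightarrow>\<^sub>E {..n})"
  proof (rule image_subsetI)
    fix t assume "t \<in> admissible \<Delta> n m"
    then have "restrict t {..m + 1} \<in> {..m + 1} \<rightarrow>\<^sub>E {..n}" using le_n by auto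
    then show "F t \<in> F ` ({..m + 1} \<rightarrow>\<^sub>E {..n})" by (metis F_restrict imageI)
  qed
  then have fin: "finite (F ` admissible \<Delta> n m)"
    by (rule finite_subset) (intro finite_imageI finite_PiE; simp)
  then have "Min (F ` admissible \<Delta> n m) \<in> F ` admissible \<Delta> n m"
    using assms by (intro Min_in) auto
  then obtain t where t: "t \<in> admissible \<Delta> n m" "F t = Min (F ` admissible \<Delta> n m)"
    by auto
  have le: "rss m x \<rho> t (d t) \<le> rss m x \<rho> t' \<delta>'" if "t' \<in> admissible \<Delta> n m" for t' \<delta>'
  proof -
    have "F t \<le> F t'" unfolding t(2) using fin that by (intro Min_le) auto
    then show ?thesis using min_d[of t' \<delta>'] unfolding F_def by linarith
  qed
  have "SS \<Delta> n m x \<rho> = rss m x \<rho> t (d t)"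
    unfolding SS_def by (rule cInf_eq_minimum) (use t(1) le in auto)
  then show thesis using that t(1) le by blast
qed

end

theory Submission
  imports Defs
begin

text \<open>Put \<open>r = \<rho>_bar n\<close> and \<open>e i = \<epsilon> i - (r - \<rho>) * z (i - 1)\<close>. On the \<open>l\<close>-th true segment the
quasi-differences \<open>z i - r * z (i - 1)\<close> equal \<open>\<theta> l + e i\<close> with the constant level
\<open>\<theta> l = (1 - \<rho>) * \<mu> l\<close>. Choosing the true segmentation and the levels \<open>\<theta>\<close> in the definition of
\<open>SS\<close> bounds its value for the true number of change-points by \<open>\<Sum> (e i)\<^sup>2\<close>, so all other values of
\<open>SS\<close> only have to be compared with this one sum.

Let \<open>t, \<delta>\<close> be a candidate with \<open>m\<close> change-points, cut its segments further at the true
change-points, and let \<open>J\<close> range over the resulting pieces. On \<open>J\<close> the residual is \<open>e i - a\<close> with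
a constant \<open>a\<close>, and completing the square (\<open>shifted_sum_squares_ge\<close>, \<open>rss_ge\<close>) gives
\<open>rss \<ge> \<Sum> (e i)\<^sup>2 + (\<Sum>\<^sub>J |J| * (a J)\<^sup>2) / 2 - 2 * (\<Sum>\<^sub>J (\<Sum>\<^sub>i e i)\<^sup>2 / |J|)\<close>, where \<open>i\<close> ranges over \<open>J\<close>.
If \<open>m\<close> is too small, then some true change-point is the centre of a window of length proportional
to \<open>n\<close> that no point of \<open>t\<close> hits; a single level \<open>\<delta> k\<close> cannot fit the two different true levels
there, so the middle term is at least a constant times \<open>n\<close> (\<open>level_mismatch_ge\<close>), which
dominates the penalty because \<open>\<beta> n\<close> tends to 0. If \<open>m\<close> is too large, the penalty exceeds the true
one by at least \<open>\<beta> n\<close> after normalisation. Hence the theorem follows once the last sum is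
\<open>o\<close> of \<open>n * \<beta> n\<close> in probability, uniformly over all admissible \<open>t\<close>
(\<open>penalised_criterion_selects\<close>).

There are boundedly many pieces, and each of them is either a full candidate segment, of length at
least \<open>\<Delta> n\<close>, or has a true change-point as one endpoint. To bound the noise over all intervals of
length at least \<open>d\<close> at once, cut \<open>{1..n}\<close> into blocks of length \<open>d\<close>: a long interval meets at most
three times as many blocks as its length divided by \<open>d\<close>, and Cauchy-Schwarz bounds
\<open>(\<Sum>\<^sub>J \<epsilon>)\<^sup>2 / |J|\<close> by \<open>12 / d\<close> times the sum over all blocks of the squared largest partial sum
(\<open>long_sum_le_block_energy\<close>). Doob's maximal inequality bounds the expectation of this by a
multiple of \<open>n / d + 1\<close>. For \<open>d = \<Delta> n\<close> this is negligible because \<open>\<Delta> n * \<beta> n\<close> tends to infinity.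
The pieces that touch a true change-point are treated with \<open>d = sqrt n\<close> when they are longer than
that; shorter ones lie within \<open>sqrt n\<close> of a true change-point, where the noise has energy of order
\<open>sqrt n\<close>. Both are negligible because \<open>sqrt n * \<beta> n\<close> tends to infinity. Doob's inequality is obtained
by taking expectations in a pathwise inequality (\<open>pathwise_doob\<close>). Only second moments enter, so the
Gaussian case is an instance of the general one.

Finally the estimation error of \<open>r\<close> contributes at most twice \<open>(r - \<rho>)\<^sup>2 * \<Sum> (z (i - 1))\<^sup>2\<close> to each piece.
The recursion is a contraction, so the sum has expectation of order \<open>n\<close> (\<open>lag_energy_le\<close>), while
\<open>(r - \<rho>)\<^sup>2\<close> is of order \<open>1 / n\<close>.\<close>

section \<open>Residuals on the common refinement of two segmentations\<close>

lemma sum_over_segments: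
  fixes f :: "nat \<Rightarrow> 'b::comm_monoid_add" and s :: "nat \<Rightarrow> nat"
  assumes "\<And>k. k \<le> m \<Longrightarrow> s k \<le> s (k + 1)"
  shows "(\<Sum>k=0..m. \<Sum>i=s k + 1..s (k + 1). f i) = (\<Sum>i=s 0 + 1..s (m + 1). f i)"
  using assms
proof (induction m)
  case (Suc m)
  note step = Suc.prems
  have le: "s 0 \<le> s (Suc m)" 
  proof -
    have "k \<le> Suc m \<Longrightarrow> s 0 \<le> s k" for k
    proof (induction k)
      case (Suc k)
      then show ?case using step[of k] by simp
    qed simp
    then show ?thesis by simp
  qed
  have "(\<Sum>k=0..Suc m. \<Sum>i=s k + 1..s (k + 1). f i)
      = (\<Sum>i=s 0 + 1..s (m + 1). f i) + (\<Sum>i=s (Suc m) + 1..s (Suc m + 1). f i)"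
    using Suc by simp
  also have "\<dots> = (\<Sum>i\<in>{s 0 + 1..s (m + 1)} \<union> {s (Suc m) + 1..s (Suc m + 1)}. f i)"
    by (rule sum.union_disjoint [symmetric]) auto
  also have "{s 0 + 1..s (m + 1)} \<union> {s (Suc m) + 1..s (Suc m + 1)} = {s 0 + 1..s (Suc m + 1)}"
    using le Suc.prems[of "Suc m"] by auto
  finally show ?case .
qed simp

text \<open>The common refinement of two segmentations is indexed by all pairs of segments; pairs that do
not meet give the empty set, on which all the sums below vanish. This avoids having to enumerate
the merged change-points in order.\<close>

definition overlap :: "(nat \<Rightarrow> nat) \<Rightarrow> (nat \<Rightarrow> nat) \<Rightarrow> nat \<Rightarrow> nat \<Rightarrow> nat set" where
  "overlap t s k l = {max (t k) (s l) + 1..min (t (k + 1)) (s (l + 1))}"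

lemma overlap_eq: "overlap t s k l = {t k + 1..t (k + 1)} \<inter> {s l + 1..s (l + 1)}"
  unfolding overlap_def by auto

lemma finite_overlap [simp]: "finite (overlap t s k l)"
  by (simp add: overlap_def)

lemma segment_sum_over_overlaps:
  fixes f :: "nat \<Rightarrow> 'b::comm_monoid_add"
  assumes s: "s 0 = 0" "s (p + 1) = n" "\<And>l. l \<le> p \<Longrightarrow> s l \<le> s (l + 1)"
    and t: "t (k + 1) \<le> n"
  shows "(\<Sum>i=t k + 1..t (k + 1). f i) = (\<Sum>l=0..p. \<Sum>i\<in>overlap t s k l. f i)"
proof -
  let ?I = "{t k + 1..t (k + 1)}"
  have "(\<Sum>l=0..p. \<Sum>i\<in>overlap t s k l. f i)
      = (\<Sum>l=0..p. \<Sum>i=s l + 1..s (l + 1). if i \<in> ?I then f i else 0)"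
  proof (rule sum.cong[OF refl])
    fix l
    have "overlap t s k l = {s l + 1..s (l + 1)} \<inter> ?I" by (simp only: overlap_eq Int_commute)
    then show "sum f (overlap t s k l) = (\<Sum>i=s l + 1..s (l + 1). if i \<in> ?I then f i else 0)"
      by (simp only: sum.inter_restrict finite_atLeastAtMost)
  qed
  also have "\<dots> = (\<Sum>i=1..n. if i \<in> ?I then f i else 0)"
    using sum_over_segments[of p s "\<lambda>i. if i \<in> ?I then f i else 0"] s by simp
  also have "\<dots> = (\<Sum>i\<in>{1..n} \<inter> ?I. f i)"
    by (simp only: sum.inter_restrict finite_atLeastAtMost)
  also have "{1..n} \<inter> ?I = ?I" using t by auto
  finally show ?thesis by simp
qed

text \<open>For nonempty \<open>J\<close>, with \<open>E = \<Sum> e i\<close> and \<open>c = card J\<close>, the two sides differ by \<open>(c * a - 2 * E)\<^sup>2 / (2 * c)\<close>. Keeping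
half of the quadratic term lets the same inequality serve both for superfluous change-points,
where that term is dropped, and for missing ones, where it carries the gain.\<close>

lemma shifted_sum_squares_ge:
  fixes e :: "nat \<Rightarrow> real" and a :: real
  assumes "finite J"
  shows "(\<Sum>i\<in>J. (e i - a)\<^sup>2) \<ge> (\<Sum>i\<in>J. (e i)\<^sup>2) + card J * a\<^sup>2 / 2 - 2 * ((\<Sum>i\<in>J. e i)\<^sup>2 / card J)"
proof (cases "J = {}")
  case False
  then have c: "real (card J) > 0" using assms by (simp add: card_gt_0_iff)
  define E where "E = (\<Sum>i\<in>J. e i)"
  define c where "c = real (card J)"
  have "(\<Sum>i\<in>J. (e i - a)\<^sup>2) = (\<Sum>i\<in>J. (e i)\<^sup>2 + a\<^sup>2 - 2 * a * e i)"
    by (rule sum.cong) (auto simp: power2_eq_square algebra_simps)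
  also have "\<dots> = (\<Sum>i\<in>J. (e i)\<^sup>2) + c * a\<^sup>2 - 2 * a * E"
    by (simp add: sum.distrib sum_subtractf sum_distrib_left E_def c_def)
  also have "(\<Sum>i\<in>J. (e i)\<^sup>2) + c * a\<^sup>2 - 2 * a * E = (\<Sum>i\<in>J. (e i)\<^sup>2) + c * a\<^sup>2 / 2 - 2 * (E\<^sup>2 / c) + (c * a - 2 * E)\<^sup>2 / (2 * c)"
    using c by (simp add: c_def field_simps power2_eq_square)
  finally have "(\<Sum>i\<in>J. (e i - a)\<^sup>2) = (\<Sum>i\<in>J. (e i)\<^sup>2) + c * a\<^sup>2 / 2 - 2 * (E\<^sup>2 / c) + (c * a - 2 * E)\<^sup>2 / (2 * c)"
    by simp
  then show ?thesis using c unfolding E_def c_def by simp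
qed simp

lemma rss_ge:
  fixes x e \<theta> :: "nat \<Rightarrow> real"
  assumes s: "s 0 = 0" "s (p + 1) = n" "\<And>l. l \<le> p \<Longrightarrow> s l \<le> s (l + 1)"
    and t: "t 0 = 0" "t (m + 1) = n" "\<And>k. k \<le> m \<Longrightarrow> t k \<le> t (k + 1)"
    and x: "\<And>l i. l \<le> p \<Longrightarrow> i \<in> {s l + 1..s (l + 1)} \<Longrightarrow> x i - r * x (i - 1) = \<theta> l + e i"
  shows "rss m x r t \<delta> \<ge> (\<Sum>i=1..n. (e i)\<^sup>2)
    + (\<Sum>k=0..m. \<Sum>l=0..p. card (overlap t s k l) * (\<delta> k - \<theta> l)\<^sup>2) / 2
    - 2 * (\<Sum>k=0..m. \<Sum>l=0..p. (\<Sum>i\<in>overlap t s k l. e i)\<^sup>2 / card (overlap t s k l))"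
proof -
  have tn: "t (k + 1) \<le> n" if "k \<le> m" for k
    using that
  proof (induction k rule: inc_induct)
    case base then show ?case using t(2) by simp
  next
    case (step j) then show ?case using t(3)[of "j + 1"] by simp
  qed
  have "rss m x r t \<delta> = (\<Sum>k=0..m. \<Sum>l=0..p. \<Sum>i\<in>overlap t s k l. (x i - r * x (i - 1) - \<delta> k)\<^sup>2)"
    unfolding rss_def
    by (intro sum.cong refl segment_sum_over_overlaps[OF s] tn) auto
  also have "\<dots> = (\<Sum>k=0..m. \<Sum>l=0..p. \<Sum>i\<in>overlap t s k l. (e i - (\<delta> k - \<theta> l))\<^sup>2)"
    by (intro sum.cong refl arg_cong[where f = "\<lambda>v. v\<^sup>2"], subst x) (auto simp: overlap_eq)
  also have "\<dots> \<ge> (\<Sum>k=0..m. \<Sum>l=0..p. (\<Sum>i\<in>overlap t s k l. (e i)\<^sup>2)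
      + card (overlap t s k l) * (\<delta> k - \<theta> l)\<^sup>2 / 2
      - 2 * ((\<Sum>i\<in>overlap t s k l. e i)\<^sup>2 / card (overlap t s k l)))"
    by (intro sum_mono shifted_sum_squares_ge) simp
  also have "(\<Sum>k=0..m. \<Sum>l=0..p. (\<Sum>i\<in>overlap t s k l. (e i)\<^sup>2)
      + card (overlap t s k l) * (\<delta> k - \<theta> l)\<^sup>2 / 2
      - 2 * ((\<Sum>i\<in>overlap t s k l. e i)\<^sup>2 / card (overlap t s k l)))
    = (\<Sum>k=0..m. \<Sum>l=0..p. \<Sum>i\<in>overlap t s k l. (e i)\<^sup>2)
    + (\<Sum>k=0..m. \<Sum>l=0..p. card (overlap t s k l) * (\<delta> k - \<theta> l)\<^sup>2) / 2
    - 2 * (\<Sum>k=0..m. \<Sum>l=0..p. (\<Sum>i\<in>overlap t s k l. e i)\<^sup>2 / card (overlap t s k l))"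
    by (simp add: sum.distrib sum_subtractf sum_distrib_left sum_divide_distrib)
  also have "(\<Sum>k=0..m. \<Sum>l=0..p. \<Sum>i\<in>overlap t s k l. (e i)\<^sup>2)
      = (\<Sum>k=0..m. \<Sum>i=t k + 1..t (k + 1). (e i)\<^sup>2)"
    by (intro sum.cong refl segment_sum_over_overlaps[OF s, symmetric] tn) auto
  also have "\<dots> = (\<Sum>i=1..n. (e i)\<^sup>2)"
    using sum_over_segments[of m t, OF t(3)] t(1,2) by simp
  finally show ?thesis .
qed

section \<open>The cost of missing a change-point\<close>

text \<open>Pigeonhole: the open windows of radius \<open>h\<close> around the \<open>p\<close> interior points of \<open>s\<close> are disjoint,
so \<open>m < p\<close> interior points of \<open>t\<close> cannot hit all of them.\<close>

lemma exists_unbroken_window: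
  fixes s t :: "nat \<Rightarrow> nat"
  assumes s: "s 0 = 0" "s (p + 1) = n" "\<And>l. l \<le> p \<Longrightarrow> s l + 2 * h \<le> s (l + 1)"
    and t: "t 0 = 0" "t (m + 1) = n" and "m < p"
  obtains j l where "j \<le> m" "l < p" "t j + h \<le> s (l + 1)" "s (l + 1) + h \<le> t (j + 1)"
proof -
  have mono: "s l + 2 * h \<le> s l'" if "l < l'" "l' \<le> p + 1" for l l'
    using that
  proof (induction l')
    case (Suc l') then show ?case using s(3)[of l'] by (cases "l = l'") fastforce+
  qed simp
  define W where "W l = {i. s (l + 1) < i + h \<and> i < s (l + 1) + h}" for l
  have "\<exists>l<p. \<forall>j\<in>{1..m}. t j \<notin> W l"
  proof (rule ccontr)
    assume "\<not> ?thesis"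
    then have "\<forall>l\<in>{..<p}. \<exists>j\<in>{1..m}. t j \<in> W l" by auto
    then obtain g where g: "\<And>l. l < p \<Longrightarrow> g l \<in> {1..m} \<and> t (g l) \<in> W l"
      by (metis lessThan_iff)
    have "inj_on g {..<p}"
    proof (rule linorder_inj_onI)
      fix l l' assume "l < l'" "l \<in> {..<p}" "l' \<in> {..<p}"
      then have "t (g l) \<in> W l" "t (g l') \<in> W l'" "s (l + 1) + 2 * h \<le> s (l' + 1)"
        using g mono[of "l + 1" "l' + 1"] by auto
      then show "g l \<noteq> g l'" by (auto simp: W_def)
    qed auto
    then have "card {..<p} \<le> card {1..m}"
      by (rule card_inj_on_le) (use g in auto)
    then show False using \<open>m < p\<close> by simp
  qed
  then obtain l where l: "l < p" "\<And>j. j \<in> {1..m} \<Longrightarrow> t j \<notin> W l" by auto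
  \<comment> \<open>The segment of \<open>t\<close> that contains the window starts at the last point of \<open>t\<close> to its left.\<close>
  define j where "j = (GREATEST j. j \<le> m \<and> t j + h \<le> s (l + 1))"
  have "0 \<le> m \<and> t 0 + h \<le> s (l + 1)" using mono[of 0 "l + 1"] l(1) t(1) by simp
  then have j: "j \<le> m \<and> t j + h \<le> s (l + 1)"
    unfolding j_def by (rule GreatestI_nat[where b = m]) simp
  have "s (l + 1) + h \<le> t (j + 1)"
  proof (cases "j = m")
    case True
    then show ?thesis using mono[of "l + 1" "p + 1"] l(1) s(2) t(2) by simp
  next
    case False
    have "\<not> (j + 1 \<le> m \<and> t (j + 1) + h \<le> s (l + 1))"
    proof
      assume "j + 1 \<le> m \<and> t (j + 1) + h \<le> s (l + 1)"
      then have "j + 1 \<le> j" unfolding j_def by (rule Greatest_le_nat[where b = m]) simp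
      then show False by simp
    qed
    then have "s (l + 1) < t (j + 1) + h" using False j by simp
    moreover have "t (j + 1) \<notin> W l" using l(2)[of "j + 1"] False j by simp
    ultimately show ?thesis by (auto simp: W_def)
  qed
  with j l(1) that show thesis by blast
qed

text \<open>On the window that is not broken by \<open>t\<close>, one value \<open>\<delta> j\<close> competes with two true levels, and
\<open>(\<delta> - u)\<^sup>2 + (\<delta> - v)\<^sup>2 \<ge> (u - v)\<^sup>2 / 2\<close>.\<close>

lemma level_mismatch_ge:
  fixes \<theta> \<delta> :: "nat \<Rightarrow> real" and h :: nat and \<kappa> :: real
  assumes s: "s 0 = 0" "s (p + 1) = n" "\<And>l. l \<le> p \<Longrightarrow> s l + 2 * h \<le> s (l + 1)"
    and t: "t 0 = 0" "t (m + 1) = n" and "m < p"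
    and jump: "\<And>l. l < p \<Longrightarrow> (\<theta> (l + 1) - \<theta> l)\<^sup>2 \<ge> \<kappa>"
  shows "(\<Sum>k=0..m. \<Sum>l=0..p. card (overlap t s k l) * (\<delta> k - \<theta> l)\<^sup>2) \<ge> h * \<kappa> / 2"
proof -
  obtain j l where jl: "j \<le> m" "l < p" "t j + h \<le> s (l + 1)" "s (l + 1) + h \<le> t (j + 1)"
    using exists_unbroken_window[OF s t \<open>m < p\<close>] by blast
  let ?f = "\<lambda>l. real (card (overlap t s j l)) * (\<delta> j - \<theta> l)\<^sup>2"
  have "h \<le> card (overlap t s j l)" "h \<le> card (overlap t s j (l + 1))"
    using jl s(3)[of l] s(3)[of "l + 1"] by (auto simp: overlap_def)
  then have "h * (\<delta> j - \<theta> l)\<^sup>2 + h * (\<delta> j - \<theta> (l + 1))\<^sup>2 \<le> ?f l + ?f (l + 1)"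
    by (intro add_mono mult_right_mono) auto
  moreover have "\<kappa> / 2 \<le> (\<delta> j - \<theta> l)\<^sup>2 + (\<delta> j - \<theta> (l + 1))\<^sup>2"
  proof -
    have "(\<delta> j - \<theta> l)\<^sup>2 + (\<delta> j - \<theta> (l + 1))\<^sup>2
        = (\<theta> (l + 1) - \<theta> l)\<^sup>2 / 2 + (2 * \<delta> j - \<theta> l - \<theta> (l + 1))\<^sup>2 / 2"
      by (simp add: power2_eq_square field_simps)
    then show ?thesis using jump[OF jl(2)] zero_le_power2[of "2 * \<delta> j - \<theta> l - \<theta> (l + 1)"] by linarith
  qed
  then have "h * (\<kappa> / 2) \<le> h * ((\<delta> j - \<theta> l)\<^sup>2 + (\<delta> j - \<theta> (l + 1))\<^sup>2)"
    by (rule mult_left_mono) simp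
  moreover have "?f l + ?f (l + 1) = sum ?f {l, l + 1}" by simp
  moreover have "sum ?f {l, l + 1} \<le> (\<Sum>l=0..p. ?f l)"
    using jl(2) by (intro sum_mono2) auto
  moreover have "(\<Sum>l=0..p. ?f l) \<le> (\<Sum>k=0..m. \<Sum>l=0..p. card (overlap t s k l) * (\<delta> k - \<theta> l)\<^sup>2)"
    using jl(1) by (intro member_le_sum[where f = "\<lambda>k. \<Sum>l=0..p. card (overlap t s k l) * (\<delta> k - \<theta> l)\<^sup>2"] sum_nonneg) auto
  ultimately show ?thesis by (simp add: algebra_simps)
qed

section \<open>Doob's maximal inequality, pathwise\<close>

primrec sup_partial :: "(nat \<Rightarrow> real) \<Rightarrow> nat \<Rightarrow> nat \<Rightarrow> real" where
  "sup_partial x a 0 = 0"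
| "sup_partial x a (Suc s) = max (sup_partial x a s) \<bar>\<Sum>i=a + 1..a + Suc s. x i\<bar>"

lemma sup_partial_nonneg: "0 \<le> sup_partial x a s"
  by (induction s) auto

lemma partial_le_sup_partial: "u \<le> s \<Longrightarrow> \<bar>\<Sum>i=a + 1..a + u. x i\<bar> \<le> sup_partial x a s"
  by (induction s) (auto simp: le_Suc_eq)

lemma sup_partial_le: "sup_partial x a s \<le> (\<Sum>i=a + 1..a + s. \<bar>x i\<bar>)"
proof (induction s)
  case (Suc s)
  have "\<bar>\<Sum>i=a + 1..a + Suc s. x i\<bar> \<le> (\<Sum>i=a + 1..a + Suc s. \<bar>x i\<bar>)" by (rule sum_abs)
  moreover have "(\<Sum>i=a + 1..a + s. \<bar>x i\<bar>) \<le> (\<Sum>i=a + 1..a + Suc s. \<bar>x i\<bar>)" by simp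
  ultimately show ?case using Suc by simp
qed simp

text \<open>The factor of \<open>x (a + Suc u)\<close> in the pathwise inequality below. It depends only on the terms
\<open>x (a + 1), \<dots>, x (a + u)\<close>, which makes the products centred for independent centred noise.\<close>

definition doob_weight :: "(nat \<Rightarrow> real) \<Rightarrow> nat \<Rightarrow> nat \<Rightarrow> real" where
  "doob_weight x a u = 8 * (\<Sum>i=a + 1..a + u. x i) - 4 * sup_partial x a u * sgn (\<Sum>i=a + 1..a + u. x i)"

text \<open>With \<open>S\<close> the partial sums and \<open>L\<close> their running maximum modulus, \<open>L\<close> increases only at times when
\<open>L = \<bar>S\<bar>\<close>. Summation by parts then gives
\<open>4 * \<Sum> L u * (\<bar>S (u + 1)\<bar> - \<bar>S u\<bar>) \<le> 4 * L s * \<bar>S s\<bar> - 2 * (L s)\<^sup>2\<close>, and by completing the square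
\<open>4 * L * \<bar>S\<bar> - L\<^sup>2 \<le> 4 * S\<^sup>2\<close>. The increments of \<open>\<bar>S\<bar>\<close> are at least \<open>sgn (S u) * x (a + Suc u)\<close>. Expanding \<open>(S s)\<^sup>2\<close> into squares and cross terms finishes the proof. Taking
expectations yields the maximal inequality in \<open>L\<^sup>2\<close> without stopping times.\<close>

lemma pathwise_doob:
  "(sup_partial x a s)\<^sup>2 \<le> 4 * (\<Sum>i=a + 1..a + s. (x i)\<^sup>2) + (\<Sum>u<s. doob_weight x a u * x (a + Suc u))"
proof -
  define S where "S u = (\<Sum>i=a + 1..a + u. x i)" for u
  define L where "L = sup_partial x a"
  have S_Suc: "S (Suc u) = S u + x (a + Suc u)" for u by (simp add: S_def)
  have L_Suc: "L (Suc u) = max (L u) \<bar>S (Suc u)\<bar>" for u by (simp add: S_def L_def)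
  have L0: "0 \<le> L u" for u unfolding L_def by (rule sup_partial_nonneg)
  have sq: "(S s)\<^sup>2 = (\<Sum>i=a + 1..a + s. (x i)\<^sup>2) + 2 * (\<Sum>u<s. S u * x (a + Suc u))"
    by (induction s) (simp_all add: S_Suc power2_sum algebra_simps, simp add: S_def)
  have "4 * (\<Sum>u<s. L u * sgn (S u) * x (a + Suc u)) \<le> 4 * L s * \<bar>S s\<bar> - 2 * (L s)\<^sup>2"
  proof (induction s)
    case (Suc s)
    have "\<bar>S (Suc s)\<bar> \<ge> \<bar>S s\<bar> + sgn (S s) * x (a + Suc s)"
      unfolding S_Suc by (cases "S s" "0::real" rule: linorder_cases) auto
    then have "L s * (\<bar>S s\<bar> + sgn (S s) * x (a + Suc s)) \<le> L s * \<bar>S (Suc s)\<bar>"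
      using L0 by (rule mult_left_mono)
    moreover have "4 * L s * \<bar>S (Suc s)\<bar> - 2 * (L s)\<^sup>2 \<le> 4 * L (Suc s) * \<bar>S (Suc s)\<bar> - 2 * (L (Suc s))\<^sup>2"
    proof (cases "L s < \<bar>S (Suc s)\<bar>")
      case True
      have "0 \<le> (L s - \<bar>S (Suc s)\<bar>)\<^sup>2" by simp
      then show ?thesis using True unfolding L_Suc
        by (simp add: max_def power2_eq_square algebra_simps)
    qed (simp add: L_Suc)
    ultimately show ?case using Suc by (simp add: algebra_simps)
  qed (simp add: L_def)
  moreover have "4 * L s * \<bar>S s\<bar> - 2 * (L s)\<^sup>2 \<le> 4 * (S s)\<^sup>2 - (L s)\<^sup>2"
    using zero_le_power2[of "2 * \<bar>S s\<bar> - L s"] by (simp add: power2_eq_square algebra_simps)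
  ultimately have "(L s)\<^sup>2 \<le> 4 * (\<Sum>i=a + 1..a + s. (x i)\<^sup>2)
      + (8 * (\<Sum>u<s. S u * x (a + Suc u)) - 4 * (\<Sum>u<s. L u * sgn (S u) * x (a + Suc u)))"
    using sq by simp
  also have "8 * (\<Sum>u<s. S u * x (a + Suc u)) - 4 * (\<Sum>u<s. L u * sgn (S u) * x (a + Suc u))
      = (\<Sum>u<s. doob_weight x a u * x (a + Suc u))"
    by (simp add: doob_weight_def S_def L_def sum_distrib_left sum_subtractf [symmetric] algebra_simps)
  finally show ?thesis by (simp add: L_def)
qed

lemma sup_partial_cong:
  "(\<And>i. i \<in> {a + 1..a + s} \<Longrightarrow> x i = y i) \<Longrightarrow> sup_partial x a s = sup_partial y a s"
proof (induction s)
  case (Suc s)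
  have "(\<Sum>i=a + 1..a + Suc s. x i) = (\<Sum>i=a + 1..a + Suc s. y i)"
    using Suc.prems by (intro sum.cong) auto
  then show ?case using Suc by simp
qed simp

lemma doob_weight_cong:
  assumes "\<And>i. i \<in> {a + 1..a + u} \<Longrightarrow> x i = y i"
  shows "doob_weight x a u = doob_weight y a u"
proof -
  have "(\<Sum>i=a + 1..a + u. x i) = (\<Sum>i=a + 1..a + u. y i)"
    using assms by (intro sum.cong) auto
  then show ?thesis using sup_partial_cong[of a u x y, OF assms] by (simp only: doob_weight_def)
qed

lemma sup_partial_measurable:
  "(\<And>i. i \<in> {a + 1..a + s} \<Longrightarrow> (\<lambda>\<omega>. x \<omega> i) \<in> borel_measurable N) \<Longrightarrow>
    (\<lambda>\<omega>. sup_partial (x \<omega>) a s) \<in> borel_measurable N"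
proof (induction s)
  case (Suc s)
  then have [measurable]: "(\<lambda>\<omega>. sup_partial (x \<omega>) a s) \<in> borel_measurable N" by simp
  have [measurable]: "(\<lambda>\<omega>. \<Sum>i=a + 1..a + Suc s. x \<omega> i) \<in> borel_measurable N"
    using Suc.prems by (intro borel_measurable_sum) auto
  show ?case unfolding sup_partial.simps by measurable
qed simp

lemma doob_weight_measurable:
  assumes "\<And>i. i \<in> {a + 1..a + u} \<Longrightarrow> (\<lambda>\<omega>. x \<omega> i) \<in> borel_measurable N"
  shows "(\<lambda>\<omega>. doob_weight (x \<omega>) a u) \<in> borel_measurable N"
proof -
  have [measurable]: "(\<lambda>\<omega>. sup_partial (x \<omega>) a u) \<in> borel_measurable N"
    using assms by (rule sup_partial_measurable)
  have [measurable]: "(\<lambda>\<omega>. \<Sum>i=a + 1..a + u. x \<omega> i) \<in> borel_measurable N"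
    using assms by (intro borel_measurable_sum) auto
  show ?thesis unfolding doob_weight_def by measurable
qed

lemma abs_doob_weight_le: "\<bar>doob_weight x a u\<bar> \<le> 12 * (\<Sum>i=a + 1..a + u. \<bar>x i\<bar>)"
proof -
  let ?S = "\<Sum>i=a + 1..a + u. x i" and ?L = "sup_partial x a u"
  have "\<bar>doob_weight x a u\<bar> \<le> 8 * \<bar>?S\<bar> + 4 * \<bar>?L * sgn ?S\<bar>"
    unfolding doob_weight_def by linarith
  also have "\<bar>?L * sgn ?S\<bar> \<le> ?L"
    using sup_partial_nonneg[of x a u] by (simp add: abs_mult sgn_if)
  also have "\<bar>?S\<bar> \<le> (\<Sum>i=a + 1..a + u. \<bar>x i\<bar>)" by (rule sum_abs)
  finally show ?thesis using sup_partial_le[of x a u] by linarith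
qed

section \<open>Noise sums over the pieces of the refinement\<close>

text \<open>The \<open>j\<close>-th block is \<open>{j * d + 1..j * d + d}\<close>; the last block may extend beyond \<open>n\<close>. The factor 12
makes the bound for long intervals hold without further constants.\<close>

definition block_energy :: "nat \<Rightarrow> nat \<Rightarrow> (nat \<Rightarrow> real) \<Rightarrow> real" where
  "block_energy d n x = 12 / d * (\<Sum>j\<le>n div d. (sup_partial x (j * d) d)\<^sup>2)"

lemma block_energy_nonneg: "0 \<le> block_energy d n x"
  unfolding block_energy_def by (intro mult_nonneg_nonneg sum_nonneg) auto

text \<open>An interval of length at least \<open>d\<close> meets the \<open>q - p + 1 \<le> 3 * (b - a) / d\<close> blocks between
\<open>p = a div d\<close> and \<open>q = b div d\<close>. Its sum is made of whole blocks and of a partial sum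
within a block at either end, hence is at most twice the sum of the block maxima, and Cauchy-Schwarz
turns this into the sum of their squares.\<close>

lemma long_sum_le_block_energy:
  fixes x :: "nat \<Rightarrow> real"
  assumes d: "0 < d" and ab: "a + d \<le> b" and bn: "b \<le> n"
  shows "(\<Sum>i=a + 1..b. x i)\<^sup>2 \<le> (real b - real a) * block_energy d n x"
proof -
  define S where "S c = (\<Sum>i=1..c. x i)" for c
  define L where "L j = sup_partial x (j * d) d" for j
  have S_diff: "S (c + u) - S c = (\<Sum>i=c + 1..c + u. x i)" for c u
    unfolding S_def by (induction u) auto
  have L0: "0 \<le> L j" for j unfolding L_def by (rule sup_partial_nonneg)
  have part: "\<bar>S c - S (c div d * d)\<bar> \<le> L (c div d)" for c
  proof -
    have "c = c div d * d + c mod d" by simp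
    then have "S c - S (c div d * d) = (\<Sum>i=c div d * d + 1..c div d * d + c mod d. x i)"
      using S_diff[of "c div d * d" "c mod d"] by simp
    then show ?thesis unfolding L_def
      using partial_le_sup_partial[of "c mod d" d x "c div d * d"] d by simp
  qed
  have block: "\<bar>S (j * d + d) - S (j * d)\<bar> \<le> L j" for j
    unfolding S_diff L_def by (rule partial_le_sup_partial) simp
  have whole: "\<bar>S ((p + r) * d) - S (p * d)\<bar> \<le> (\<Sum>j\<in>{p..<p + r}. L j)" for p r
  proof (induction r)
    case (Suc r)
    have "(p + Suc r) * d = (p + r) * d + d" by simp
    then have "S ((p + Suc r) * d) - S (p * d)
        = (S ((p + r) * d) - S (p * d)) + (S ((p + r) * d + d) - S ((p + r) * d))"
      by (simp only: algebra_simps)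
    then show ?case using Suc block[of "p + r"] by simp
  qed simp
  define p q where "p = a div d" and "q = b div d"
  have pq: "p \<le> q" unfolding p_def q_def using ab by (intro div_le_mono) simp
  have "\<bar>S b - S a\<bar> \<le> \<bar>S b - S (q * d)\<bar> + \<bar>S (q * d) - S (p * d)\<bar> + \<bar>S a - S (p * d)\<bar>" by linarith
  also have "\<dots> \<le> L q + (\<Sum>j\<in>{p..<q}. L j) + L p"
    using part[of b] part[of a] whole[of p "q - p"] pq by (auto simp: p_def q_def)
  also have "\<dots> \<le> 2 * (\<Sum>j\<in>{p..q}. L j)"
  proof -
    have "(\<Sum>j\<in>{p..q}. L j) = (\<Sum>j\<in>{p..<q}. L j) + L q"
      using pq by (metis sum.last_plus add.commute)
    moreover have "L p \<le> (\<Sum>j\<in>{p..q}. L j)" 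
      using pq L0 by (intro member_le_sum) auto
    moreover have "0 \<le> (\<Sum>j\<in>{p..<q}. L j)" by (intro sum_nonneg L0)
    ultimately show ?thesis using L0[of q] by linarith
  qed
  finally have "(S b - S a)\<^sup>2 \<le> (2 * (\<Sum>j\<in>{p..q}. L j))\<^sup>2"
    by (rule power2_le_iff_abs_le[THEN iffD2, rotated]) (intro mult_nonneg_nonneg sum_nonneg L0, simp)
  also have "\<dots> = 4 * (\<Sum>j\<in>{p..q}. 1 * L j)\<^sup>2" by (simp add: power2_eq_square)
  also have "(\<Sum>j\<in>{p..q}. 1 * L j)\<^sup>2 \<le> (\<Sum>j\<in>{p..q}. 1\<^sup>2) * (\<Sum>j\<in>{p..q}. (L j)\<^sup>2)"
    by (rule Cauchy_Schwarz_ineq_sum)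
  also have "(\<Sum>j\<in>{p..q}. 1\<^sup>2) = (real q - real p + 1)" using pq by simp
  also have "(real q - real p + 1) * (\<Sum>j\<in>{p..q}. (L j)\<^sup>2) \<le> (3 * (real b - real a) / d) * (\<Sum>j\<le>n div d. (L j)\<^sup>2)"
  proof (rule mult_mono)
    have "real q * d \<le> b" unfolding q_def by (metis of_nat_le_iff of_nat_mult times_div_less_eq_dividend mult.commute)
    moreover have "real a \<le> real p * d + d" 
    proof -
      have "a < p * d + d" unfolding p_def using d dividend_less_div_times[of d a] by simp
      then show ?thesis by (metis less_imp_le of_nat_add of_nat_le_iff of_nat_mult)
    qed
    moreover have "real a + d \<le> b" using ab by (metis of_nat_add of_nat_le_iff)
    ultimately have "(real q - real p + 1) * d \<le> 3 * (real b - real a)" by (simp add: algebra_simps)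
    then show "real q - real p + 1 \<le> 3 * (real b - real a) / d" using d by (simp add: field_simps)
    show "(\<Sum>j\<in>{p..q}. (L j)\<^sup>2) \<le> (\<Sum>j\<le>n div d. (L j)\<^sup>2)"
      using div_le_mono[OF bn, of d] by (intro sum_mono2) (auto simp: q_def)
    show "0 \<le> 3 * (real b - real a) / d" using ab by simp
  qed (intro sum_nonneg, simp)
  finally have "(S b - S a)\<^sup>2 \<le> (real b - real a) * (12 / d * (\<Sum>j\<le>n div d. (L j)\<^sup>2))"
    by (simp add: algebra_simps)
  moreover have "S b - S a = (\<Sum>i=a + 1..b. x i)"
    using S_diff[of a "b - a"] ab by simp
  ultimately show ?thesis by (simp add: block_energy_def L_def)
qed

definition near_energy :: "(nat \<Rightarrow> nat) \<Rightarrow> nat \<Rightarrow> nat \<Rightarrow> (nat \<Rightarrow> real) \<Rightarrow> real" where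
  "near_energy s p q x = (\<Sum>l\<le>p + 1. \<Sum>i=s l - q + 1..s l + q. (x i)\<^sup>2)"

lemma near_energy_nonneg: "0 \<le> near_energy s p q x"
  unfolding near_energy_def by (intro sum_nonneg) auto

lemma sum_sq_div_card_le:
  fixes x :: "nat \<Rightarrow> real"
  shows "(\<Sum>i\<in>J. x i)\<^sup>2 / card J \<le> (\<Sum>i\<in>J. (x i)\<^sup>2)"
proof (cases "card J = 0")
  case False
  have "(\<Sum>i\<in>J. 1 * x i)\<^sup>2 \<le> (\<Sum>i\<in>J. 1\<^sup>2) * (\<Sum>i\<in>J. (x i)\<^sup>2)"
    by (rule Cauchy_Schwarz_ineq_sum)
  then show ?thesis using False by (simp add: field_simps)
qed (simp add: sum_nonneg)

text \<open>A nonempty piece is the full segment of \<open>t\<close>, of length at least \<open>d\<close>, or has a point of \<open>s\<close> as an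
endpoint. In the latter case it is long on the scale \<open>q\<close> or stays within distance \<open>q\<close> of that
point. The three terms correspond to these three cases.\<close>

lemma overlap_sum_le:
  fixes x :: "nat \<Rightarrow> real"
  assumes "0 < d" "0 < q" and l: "l \<le> p" and tn: "t (k + 1) \<le> n" and td: "t k + d \<le> t (k + 1)"
  shows "(\<Sum>i\<in>overlap t s k l. x i)\<^sup>2 / card (overlap t s k l)
    \<le> block_energy d n x + block_energy q n x + near_energy s p q x"
proof -
  define a b where "a = max (t k) (s l)" and "b = min (t (k + 1)) (s (l + 1))"
  have J: "overlap t s k l = {a + 1..b}" by (simp add: overlap_def a_def b_def)
  have bn: "b \<le> n" using tn by (simp add: b_def)
  have long: "(\<Sum>i=a + 1..b. x i)\<^sup>2 / card {a + 1..b} \<le> block_energy r n x"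
    if "0 < r" "a + r \<le> b" for r
    using long_sum_le_block_energy[OF that bn, of x] that by (simp add: field_simps of_nat_diff)
  have near: "(\<Sum>i=a + 1..b. x i)\<^sup>2 / card {a + 1..b} \<le> near_energy s p q x"
    if "l' \<le> p + 1" "{a + 1..b} \<subseteq> {s l' - q + 1..s l' + q}" for l'
  proof -
    have "(\<Sum>i=a + 1..b. x i)\<^sup>2 / card {a + 1..b} \<le> (\<Sum>i=a + 1..b. (x i)\<^sup>2)"
      by (rule sum_sq_div_card_le)
    also have "\<dots> \<le> (\<Sum>i=s l' - q + 1..s l' + q. (x i)\<^sup>2)"
      using that(2) by (intro sum_mono2) auto
    also have "\<dots> \<le> near_energy s p q x"
      unfolding near_energy_def using that(1)
      by (intro member_le_sum[where f = "\<lambda>l. \<Sum>i=s l - q + 1..s l + q. (x i)\<^sup>2"] sum_nonneg) auto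
    finally show ?thesis .
  qed
  consider "b < a + 1" | "a = t k" "b = t (k + 1)" | "a < b" "a + q \<le> b"
    | "a < b" "b < a + q" "a = s l" | "a < b" "b < a + q" "b = s (l + 1)"
    unfolding a_def b_def by linarith
  then have "(\<Sum>i=a + 1..b. x i)\<^sup>2 / card {a + 1..b} \<le> block_energy d n x
      \<or> (\<Sum>i=a + 1..b. x i)\<^sup>2 / card {a + 1..b} \<le> block_energy q n x
      \<or> (\<Sum>i=a + 1..b. x i)\<^sup>2 / card {a + 1..b} \<le> near_energy s p q x"
  proof cases
    case 1
    then show ?thesis by (simp add: near_energy_nonneg)
  next
    case 2
    then show ?thesis using long[of d] assms by auto
  next
    case 3
    then show ?thesis using long[of q] assms by auto
  next
    case 4
    then show ?thesis using l by (intro disjI2 near[of l]) auto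
  next
    case 5
    then show ?thesis using l by (intro disjI2 near[of "l + 1"]) auto
  qed
  then show ?thesis
    using block_energy_nonneg[of d n x] block_energy_nonneg[of q n x] near_energy_nonneg[of s p q x]
    unfolding J by linarith
qed

section \<open>Energy of the autoregression\<close>

text \<open>Convexity of the square, applied to \<open>r * u + v\<close> as a convex combination of \<open>\<plusminus>u\<close> and
\<open>v / (1 - \<bar>r\<bar>)\<close> with weights \<open>\<bar>r\<bar>\<close> and \<open>1 - \<bar>r\<bar>\<close>, gives
\<open>(z i)\<^sup>2 \<le> \<bar>r\<bar> * (z (i - 1))\<^sup>2 + (w i)\<^sup>2 / (1 - \<bar>r\<bar>)\<close>; summing over \<open>i\<close> gives the bound.\<close>

lemma ar1_energy_le:
  fixes z w :: "nat \<Rightarrow> real"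
  assumes r: "\<bar>r\<bar> < 1" and rec: "\<And>i. 1 \<le> i \<Longrightarrow> i \<le> n \<Longrightarrow> z i = r * z (i - 1) + w i"
  shows "(\<Sum>i=1..n. (z (i - 1))\<^sup>2) \<le> ((z 0)\<^sup>2 + (\<Sum>i=1..n. (w i)\<^sup>2) / (1 - \<bar>r\<bar>)) / (1 - \<bar>r\<bar>)"
proof -
  have convex: "(r * u + v)\<^sup>2 \<le> \<bar>r\<bar> * u\<^sup>2 + v\<^sup>2 / (1 - \<bar>r\<bar>)" for u v :: real
  proof -
    define c where "c = 1 - \<bar>r\<bar>"
    have c: "c > 0" "\<bar>r\<bar> = 1 - c" using r by (auto simp: c_def)
    have rr: "r\<^sup>2 = (1 - c)\<^sup>2" using c(2) by (metis power2_abs)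
    have "2 * (r * u) * v \<le> \<bar>r\<bar> * (2 * (\<bar>u\<bar> * \<bar>v\<bar>))" 
      using abs_ge_self[of "2 * (r * u) * v"] by (simp add: abs_mult algebra_simps)
    also have "2 * (\<bar>u\<bar> * \<bar>v\<bar>) \<le> c * u\<^sup>2 + v\<^sup>2 / c"
    proof -
      have "c * u\<^sup>2 + v\<^sup>2 / c - 2 * (\<bar>u\<bar> * \<bar>v\<bar>) = (c * \<bar>u\<bar> - \<bar>v\<bar>)\<^sup>2 / c"
        using c by (simp add: power2_diff field_simps power2_eq_square[of c])
      then show ?thesis using c by (smt (verit) divide_nonneg_pos zero_le_power2)
    qed
    finally have "2 * (r * u) * v \<le> (1 - c) * (c * u\<^sup>2 + v\<^sup>2 / c)"
      using c(2) by (simp add: mult_left_mono)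
    then have "(r * u + v)\<^sup>2 \<le> (1 - c)\<^sup>2 * u\<^sup>2 + v\<^sup>2 + (1 - c) * (c * u\<^sup>2 + v\<^sup>2 / c)"
      using rr by (simp add: power2_sum power_mult_distrib)
    also have "\<dots> = (1 - c) * u\<^sup>2 + v\<^sup>2 / c"
      using c(1) by (simp add: field_simps power2_eq_square)
    finally show ?thesis using c by simp
  qed
  have step: "(1 - \<bar>r\<bar>) * (\<Sum>i=1..k. (z (i - 1))\<^sup>2) + (z k)\<^sup>2 \<le> (z 0)\<^sup>2 + (\<Sum>i=1..k. (w i)\<^sup>2) / (1 - \<bar>r\<bar>)"
    if "k \<le> n" for k
    using that
  proof (induction k)
    case (Suc k)
    have "(z (Suc k))\<^sup>2 \<le> \<bar>r\<bar> * (z k)\<^sup>2 + (w (Suc k))\<^sup>2 / (1 - \<bar>r\<bar>)"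
      using rec[of "Suc k"] convex[of "z k" "w (Suc k)"] Suc.prems by simp
    then show ?case using Suc by (simp add: algebra_simps add_divide_distrib)
  qed simp
  have "(\<Sum>i=1..n. (z (i - 1))\<^sup>2) * (1 - \<bar>r\<bar>) \<le> (z 0)\<^sup>2 + (\<Sum>i=1..n. (w i)\<^sup>2) / (1 - \<bar>r\<bar>)"
    using step[OF order_refl] zero_le_power2[of "z n"]
    by (subst mult.commute) linarith
  then show ?thesis using r by (simp add: pos_le_divide_eq)
qed

lemma in_some_segment:
  fixes s :: "nat \<Rightarrow> nat"
  shows "s 0 < i \<Longrightarrow> i \<le> s (p + 1) \<Longrightarrow> \<exists>l\<le>p. i \<in> {s l + 1..s (l + 1)}"
proof (induction p)
  case (Suc p)
  show ?case
  proof (cases "i \<le> s (p + 1)")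
    case True
    then show ?thesis using Suc by (meson le_SucI)
  next
    case False
    then show ?thesis using Suc.prems by (intro exI[of _ "Suc p"]) auto
  qed
qed auto

text \<open>The bound of \<open>ar1_energy_le\<close> for the inputs \<open>\<theta> l + \<epsilon> i\<close>, where \<open>T\<close> bounds the squared levels. It involves
only the initial value and the noise, so its integrability and expectation are immediate.\<close>

definition lag_energy_bound :: "real \<Rightarrow> real \<Rightarrow> nat \<Rightarrow> real \<Rightarrow> (nat \<Rightarrow> real) \<Rightarrow> real" where
  "lag_energy_bound r T n x0 \<epsilon> = (x0\<^sup>2 + (\<Sum>i=1..n. 2 * T + 2 * (\<epsilon> i)\<^sup>2) / (1 - \<bar>r\<bar>)) / (1 - \<bar>r\<bar>)"

lemma lag_energy_le:
  fixes x \<epsilon> \<theta> :: "nat \<Rightarrow> real"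
  assumes r: "\<bar>r\<bar> < 1" and s: "s 0 = 0" "s (p + 1) = n"
    and model: "\<And>l i. l \<le> p \<Longrightarrow> i \<in> {s l + 1..s (l + 1)} \<Longrightarrow> x i - r * x (i - 1) = \<theta> l + \<epsilon> i"
    and T: "\<And>l. l \<le> p \<Longrightarrow> (\<theta> l)\<^sup>2 \<le> T"
  shows "(\<Sum>i=1..n. (x (i - 1))\<^sup>2) \<le> lag_energy_bound r T n (x 0) \<epsilon>"
proof -
  define w where "w i = x i - r * x (i - 1)" for i
  have "(w i)\<^sup>2 \<le> 2 * T + 2 * (\<epsilon> i)\<^sup>2" if "i \<in> {1..n}" for i
  proof -
    have "s 0 < i" "i \<le> s (p + 1)" using that s by auto
    then obtain l where l: "l \<le> p" "i \<in> {s l + 1..s (l + 1)}"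
      using in_some_segment by blast
    have "(\<theta> l + \<epsilon> i)\<^sup>2 \<le> 2 * (\<theta> l)\<^sup>2 + 2 * (\<epsilon> i)\<^sup>2"
      using zero_le_power2[of "\<theta> l - \<epsilon> i"] by (simp add: power2_eq_square algebra_simps)
    then show ?thesis using model[OF l] T[OF l(1)] by (simp add: w_def)
  qed
  then have "(\<Sum>i=1..n. (w i)\<^sup>2) \<le> (\<Sum>i=1..n. 2 * T + 2 * (\<epsilon> i)\<^sup>2)" by (rule sum_mono)
  moreover have "(\<Sum>i=1..n. (x (i - 1))\<^sup>2) \<le> ((x 0)\<^sup>2 + (\<Sum>i=1..n. (w i)\<^sup>2) / (1 - \<bar>r\<bar>)) / (1 - \<bar>r\<bar>)"
    by (rule ar1_energy_le[OF r]) (simp add: w_def)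
  ultimately show ?thesis
    unfolding lag_energy_bound_def using r
    by (elim order_trans) (intro divide_right_mono add_left_mono, auto)
qed

section \<open>Selection for a fixed outcome\<close>

text \<open>The autoregressive part of the sum is controlled by Cauchy-Schwarz alone: the energy over the
whole sample bounds it on every piece.\<close>

lemma overlap_residual_le:
  fixes \<epsilon> x :: "nat \<Rightarrow> real"
  assumes "0 < d" "0 < q" "l \<le> p" and tn: "t (k + 1) \<le> n" and "t k + d \<le> t (k + 1)"
  shows "(\<Sum>i\<in>overlap t s k l. \<epsilon> i - c * x (i - 1))\<^sup>2 / card (overlap t s k l)
    \<le> 2 * (block_energy d n \<epsilon> + block_energy q n \<epsilon> + near_energy s p q \<epsilon>
        + c\<^sup>2 * (\<Sum>i=1..n. (x (i - 1))\<^sup>2))"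
proof -
  let ?J = "overlap t s k l"
  let ?E = "\<Sum>i\<in>?J. \<epsilon> i" and ?X = "\<Sum>i\<in>?J. x (i - 1)"
  have "(\<Sum>i\<in>?J. \<epsilon> i - c * x (i - 1)) = ?E - c * ?X"
    by (simp add: sum_subtractf sum_distrib_left)
  moreover have "(?E - c * ?X)\<^sup>2 \<le> 2 * ?E\<^sup>2 + 2 * (c\<^sup>2 * ?X\<^sup>2)"
    using zero_le_power2[of "?E + c * ?X"] by (simp add: power2_eq_square algebra_simps)
  ultimately have "(\<Sum>i\<in>?J. \<epsilon> i - c * x (i - 1))\<^sup>2 / card ?J \<le> (2 * ?E\<^sup>2 + 2 * (c\<^sup>2 * ?X\<^sup>2)) / card ?J"
    by (intro divide_right_mono) auto
  also have "\<dots> = 2 * (?E\<^sup>2 / card ?J) + 2 * (c\<^sup>2 * (?X\<^sup>2 / card ?J))"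
    by (simp add: add_divide_distrib)
  finally have "(\<Sum>i\<in>?J. \<epsilon> i - c * x (i - 1))\<^sup>2 / card ?J
      \<le> 2 * (?E\<^sup>2 / card ?J) + 2 * (c\<^sup>2 * (?X\<^sup>2 / card ?J))" .
  moreover have "?E\<^sup>2 / card ?J \<le> block_energy d n \<epsilon> + block_energy q n \<epsilon> + near_energy s p q \<epsilon>"
    by (rule overlap_sum_le[OF assms])
  moreover have "c\<^sup>2 * (?X\<^sup>2 / card ?J) \<le> c\<^sup>2 * (\<Sum>i=1..n. (x (i - 1))\<^sup>2)"
  proof (rule mult_left_mono)
    have "?X\<^sup>2 / card ?J \<le> (\<Sum>i\<in>?J. (x (i - 1))\<^sup>2)" by (rule sum_sq_div_card_le)
    also have "\<dots> \<le> (\<Sum>i=1..n. (x (i - 1))\<^sup>2)"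
      using tn by (intro sum_mono2) (auto simp: overlap_def)
    finally show "?X\<^sup>2 / card ?J \<le> (\<Sum>i=1..n. (x (i - 1))\<^sup>2)" .
  qed simp
  ultimately show ?thesis by argo
qed

lemma admissibleD:
  assumes "t \<in> admissible \<Delta> n m"
  shows "t 0 = 0" "t (m + 1) = n"
    and "k \<le> m \<Longrightarrow> t k \<le> t (k + 1)"
    and "k \<le> m \<Longrightarrow> t k + nat \<lceil>\<Delta> n\<rceil> \<le> t (k + 1)"
    and "k \<le> m \<Longrightarrow> t (k + 1) \<le> n"
proof -
  show t: "t 0 = 0" "t (m + 1) = n" using assms by (auto simp: admissible_def)
  have gap: "t k < t (k + 1) \<and> \<Delta> n \<le> real (t (k + 1)) - real (t k)" if "k \<le> m" for k
  proof -
    have "k + 1 \<in> {1..m + 1}" using that by simp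
    then have "t (k + 1 - 1) < t (k + 1) \<and> \<Delta> n \<le> real (t (k + 1)) - real (t (k + 1 - 1))"
      using assms unfolding admissible_def by blast
    then show ?thesis by simp
  qed
  then show "k \<le> m \<Longrightarrow> t k \<le> t (k + 1)" by (simp add: less_imp_le)
  show "k \<le> m \<Longrightarrow> t k + nat \<lceil>\<Delta> n\<rceil> \<le> t (k + 1)"
    using gap[of k] by (simp add: le_diff_conv2[symmetric] nat_le_iff ceiling_le_iff of_nat_diff)
      linarith
  show "k \<le> m \<Longrightarrow> t (k + 1) \<le> n"
  proof (induction k rule: inc_induct)
    case base then show ?case using t(2) by simp
  next
    case (step j) then show ?case using gap[of "j + 1"] by simp
  qed
qed

lemma admissible_nonempty:
  assumes "m \<le> K" "1 \<le> n div (K + 1)" "\<Delta> n \<le> real (n div (K + 1))"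
  shows "admissible \<Delta> n m \<noteq> {}"
proof -
  define g where "g = n div (K + 1)"
  define t where "t k = (if k \<le> m then k * g else n)" for k
  have "(m + 1) * g \<le> (K + 1) * g" using assms(1) by (intro mult_right_mono) auto
  also have "\<dots> \<le> n" unfolding g_def by (rule times_div_less_eq_dividend)
  finally have mg: "m * g + g \<le> n" by simp
  have gap: "t (k - 1) + g \<le> t k" if "k \<in> {1..m + 1}" for k
  proof (cases "k \<le> m")
    case True
    then show ?thesis using that by (cases k) (auto simp: t_def)
  next
    case False
    then have "k = m + 1" using that by simp
    then show ?thesis using mg by (simp add: t_def)
  qed
  have "t \<in> admissible \<Delta> n m"
    unfolding admissible_def
  proof (intro CollectI conjI ballI)
    show "t 0 = 0" "t (m + 1) = n" by (auto simp: t_def)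
    fix k assume k: "k \<in> {1..m + 1}"
    show "t (k - 1) < t k" using gap[OF k] assms(2) by (simp add: g_def)
    have "real (t (k - 1)) + real g \<le> real (t k)"
      using gap[OF k] by (metis of_nat_add of_nat_le_iff)
    then show "\<Delta> n \<le> real (t k) - real (t (k - 1))" using assms(3) by (simp add: g_def)
  qed
  then show ?thesis by blast
qed

text \<open>The deterministic core. The assumption \<open>noise\<close> makes every lower bound for \<open>SS\<close> lose less than
\<open>n * \<beta>\<close>, which is the least possible surplus in penalty of a model that is too large. The
assumption \<open>signal\<close> makes the gain from a missed change-point pay for this loss and for the
whole penalty of the true model.\<close>

lemma penalised_criterion_selects:
  fixes x \<epsilon> \<theta> :: "nat \<Rightarrow> real" and h q :: nat and \<beta> \<kappa> \<rho> r :: real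
  assumes model: "\<And>l i. l \<le> p \<Longrightarrow> i \<in> {s l + 1..s (l + 1)} \<Longrightarrow> x i - \<rho> * x (i - 1) = \<theta> l + \<epsilon> i"
    and s: "s \<in> admissible \<Delta> n p" "\<And>l. l \<le> p \<Longrightarrow> s l + 2 * h \<le> s (l + 1)"
    and jump: "\<And>l. l < p \<Longrightarrow> (\<theta> (l + 1) - \<theta> l)\<^sup>2 \<ge> \<kappa>"
    and ne: "\<And>m. m \<le> m_max \<Longrightarrow> admissible \<Delta> n m \<noteq> {}"
    and pos: "0 < n" "0 < \<Delta> n" "0 < q" and "0 < \<beta>"
    and noise: "4 * (real m_max + 1) * (real p + 1) * (block_energy (nat \<lceil>\<Delta> n\<rceil>) n \<epsilon> + block_energy q n \<epsilon>
        + near_energy s p q \<epsilon> + (r - \<rho>)\<^sup>2 * (\<Sum>i=1..n. (x (i - 1))\<^sup>2)) < n * \<beta>"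
    and signal: "n * \<beta> * (real p + 1) \<le> h * \<kappa> / 4"
    and "p \<le> m_max"
    and arg_min: "is_arg_min (\<lambda>m. SS \<Delta> n m x r / n + \<beta> * real m) (\<lambda>m. m \<le> m_max) m_hat"
  shows "m_hat = p"
proof (rule ccontr)
  assume "m_hat \<noteq> p"
  define e where "e i = \<epsilon> i - (r - \<rho>) * x (i - 1)" for i
  define V where "V = block_energy (nat \<lceil>\<Delta> n\<rceil>) n \<epsilon> + block_energy q n \<epsilon>
        + near_energy s p q \<epsilon> + (r - \<rho>)\<^sup>2 * (\<Sum>i=1..n. (x (i - 1))\<^sup>2)"
  have V0: "0 \<le> V" unfolding V_def
    by (intro add_nonneg_nonneg mult_nonneg_nonneg block_energy_nonneg near_energy_nonneg sum_nonneg) auto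
  note sD = admissibleD[OF s(1)]
  have xe: "x i - r * x (i - 1) = \<theta> l + e i" if "l \<le> p" "i \<in> {s l + 1..s (l + 1)}" for l i
    using model[OF that] by (simp add: e_def algebra_simps)
  have mh: "m_hat \<le> m_max" using arg_min by (simp add: is_arg_min_def)
  have "SS \<Delta> n p x r \<le> rss p x r s \<theta>"
    using SS_attained[OF ne[OF \<open>p \<le> m_max\<close>], of x r] s(1) by metis
  also have "rss p x r s \<theta> = (\<Sum>k=0..p. \<Sum>i=s k + 1..s (k + 1). (e i)\<^sup>2)"
    unfolding rss_def
  proof (intro sum.cong refl)
    fix k i assume "k \<in> {0..p}" "i \<in> {s k + 1..s (k + 1)}"
    then have "x i - r * x (i - 1) - \<theta> k = e i" using xe[of k i] by auto
    then show "(x i - r * x (i - 1) - \<theta> k)\<^sup>2 = (e i)\<^sup>2" by (rule arg_cong)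
  qed
  also have "\<dots> = (\<Sum>i=1..n. (e i)\<^sup>2)"
    using sum_over_segments[of p s "\<lambda>i. (e i)\<^sup>2"] sD(1-3) by simp
  finally have upper: "SS \<Delta> n p x r \<le> (\<Sum>i=1..n. (e i)\<^sup>2)" .
  obtain t \<delta> where t: "t \<in> admissible \<Delta> n m_hat" "SS \<Delta> n m_hat x r = rss m_hat x r t \<delta>"
    using SS_attained[OF ne[OF mh], of x r] by metis
  note tD = admissibleD[OF t(1)]
  define Q where "Q = (\<Sum>k=0..m_hat. \<Sum>l=0..p. card (overlap t s k l) * (\<delta> k - \<theta> l)\<^sup>2)"
  have "(\<Sum>k=0..m_hat. \<Sum>l=0..p. (\<Sum>i\<in>overlap t s k l. e i)\<^sup>2 / card (overlap t s k l))
      \<le> (\<Sum>k=0..m_hat. \<Sum>l=0..p. 2 * V)"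
    unfolding e_def V_def using pos tD(4,5)
    by (intro sum_mono overlap_residual_le) auto
  also have "\<dots> = 2 * (real m_hat + 1) * (real p + 1) * V" by (simp add: algebra_simps)
  also have "\<dots> \<le> 2 * (real m_max + 1) * (real p + 1) * V"
    using mh V0 by (intro mult_right_mono) auto
  finally have "2 * (\<Sum>k=0..m_hat. \<Sum>l=0..p. (\<Sum>i\<in>overlap t s k l. e i)\<^sup>2 / card (overlap t s k l)) < n * \<beta>"
    using noise unfolding V_def[symmetric] by linarith
  moreover have "SS \<Delta> n m_hat x r \<ge> (\<Sum>i=1..n. (e i)\<^sup>2) + Q / 2
      - 2 * (\<Sum>k=0..m_hat. \<Sum>l=0..p. (\<Sum>i\<in>overlap t s k l. e i)\<^sup>2 / card (overlap t s k l))"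
    unfolding t(2) Q_def using sD(1-3) tD(1-3) xe by (intro rss_ge) auto
  ultimately have lower: "SS \<Delta> n m_hat x r > (\<Sum>i=1..n. (e i)\<^sup>2) + Q / 2 - n * \<beta>" by linarith
  have "SS \<Delta> n p x r + n * \<beta> * p < SS \<Delta> n m_hat x r + n * \<beta> * m_hat"
  proof (cases "m_hat < p")
    case True
    have "Q \<ge> h * \<kappa> / 2"
      unfolding Q_def using sD(1,2) s(2) tD(1,2) True jump by (intro level_mismatch_ge) auto
    moreover have "0 \<le> n * \<beta> * m_hat" using \<open>0 < \<beta>\<close> by simp
    ultimately show ?thesis using lower upper signal by (simp add: algebra_simps)
  next
    case False
    then have "real p + 1 \<le> real m_hat" using \<open>m_hat \<noteq> p\<close> by linarith
    then have "n * \<beta> * (real p + 1) \<le> n * \<beta> * real m_hat"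
      using \<open>0 < \<beta>\<close> by (intro mult_left_mono) auto
    moreover have "0 \<le> Q" unfolding Q_def by (intro sum_nonneg) auto
    ultimately show ?thesis using lower upper by (simp add: algebra_simps)
  qed
  then have "(SS \<Delta> n p x r + n * \<beta> * p) / n < (SS \<Delta> n m_hat x r + n * \<beta> * m_hat) / n"
    using pos(1) by (simp add: divide_strict_right_mono)
  then have "SS \<Delta> n p x r / n + \<beta> * p < SS \<Delta> n m_hat x r / n + \<beta> * m_hat"
    using pos(1) by (simp add: add_divide_distrib)
  then show False using arg_min \<open>p \<le> m_max\<close> by (auto simp: is_arg_min_def)
qed

section \<open>Expected size of the noise terms\<close>

context prob_space
begin

text \<open>Expectation of the pathwise inequality: each weight is a function of noise variables that are
independent of the factor it multiplies, so these products have mean zero.\<close>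

lemma sup_partial_second_moment:
  fixes \<epsilon> :: "nat \<Rightarrow> 'a \<Rightarrow> real"
  assumes ind: "indep_vars (\<lambda>_. borel) \<epsilon> {1..}"
    and sq: "\<And>i. 1 \<le> i \<Longrightarrow> integrable M (\<lambda>\<omega>. (\<epsilon> i \<omega>)\<^sup>2)"
    and mean: "\<And>i. 1 \<le> i \<Longrightarrow> expectation (\<epsilon> i) = 0"
    and var: "\<And>i. 1 \<le> i \<Longrightarrow> expectation (\<lambda>\<omega>. (\<epsilon> i \<omega>)\<^sup>2) = v"
  shows "integrable M (\<lambda>\<omega>. (sup_partial (\<lambda>i. \<epsilon> i \<omega>) a s)\<^sup>2)" (is ?int)
    and "expectation (\<lambda>\<omega>. (sup_partial (\<lambda>i. \<epsilon> i \<omega>) a s)\<^sup>2) \<le> 4 * real s * v" (is ?le)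
proof -
  have meas [measurable]: "\<epsilon> i \<in> borel_measurable M" if "1 \<le> i" for i
    using ind that unfolding indep_vars_def2 by auto
  have int: "integrable M (\<epsilon> i)" if "1 \<le> i" for i
    using square_integrable_imp_integrable[OF meas[OF that] sq[OF that]] .
  define W where "W u \<omega> = doob_weight (\<lambda>i. \<epsilon> i \<omega>) a u" for u \<omega>
  have W_meas: "W u \<in> borel_measurable M" for u
    unfolding W_def by (rule doob_weight_measurable) simp
  have W_int: "integrable M (W u)" for u
  proof (rule Bochner_Integration.integrable_bound)
    show "integrable M (\<lambda>\<omega>. 12 * (\<Sum>i=a + 1..a + u. \<bar>\<epsilon> i \<omega>\<bar>))"
      using int by (intro integrable_mult_right Bochner_Integration.integrable_sum integrable_abs) auto
    show "AE \<omega> in M. norm (W u \<omega>) \<le> norm (12 * (\<Sum>i=a + 1..a + u. \<bar>\<epsilon> i \<omega>\<bar>))"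
      using abs_doob_weight_le unfolding W_def by (auto simp: sum_nonneg)
  qed (rule W_meas)
  have indep: "indep_var borel (W u) borel (\<epsilon> (a + Suc u))" for u
  proof -
    let ?A = "{a + 1..a + u}" and ?B = "{a + Suc u}"
    have "indep_var (PiM ?A (\<lambda>_. borel)) (\<lambda>\<omega>. \<lambda>i\<in>?A. \<epsilon> i \<omega>) (PiM ?B (\<lambda>_. borel)) (\<lambda>\<omega>. \<lambda>i\<in>?B. \<epsilon> i \<omega>)"
      by (rule indep_var_restrict[OF ind]) auto
    then have "indep_var borel ((\<lambda>x. doob_weight x a u) \<circ> (\<lambda>\<omega>. \<lambda>i\<in>?A. \<epsilon> i \<omega>))
        borel ((\<lambda>x. x (a + Suc u)) \<circ> (\<lambda>\<omega>. \<lambda>i\<in>?B. \<epsilon> i \<omega>))"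
      by (rule indep_var_compose)
        (auto intro!: doob_weight_measurable measurable_component_singleton)
    moreover have "(\<lambda>x. doob_weight x a u) \<circ> (\<lambda>\<omega>. \<lambda>i\<in>?A. \<epsilon> i \<omega>) = W u"
      unfolding W_def comp_def by (intro ext doob_weight_cong) auto
    moreover have "(\<lambda>x. x (a + Suc u)) \<circ> (\<lambda>\<omega>. \<lambda>i\<in>?B. \<epsilon> i \<omega>) = \<epsilon> (a + Suc u)"
      by (auto simp: comp_def)
    ultimately show ?thesis by simp
  qed
  have prod_int: "integrable M (\<lambda>\<omega>. W u \<omega> * \<epsilon> (a + Suc u) \<omega>)" for u
    by (rule indep_var_integrable[OF indep W_int int]) simp
  have prod_mean: "expectation (\<lambda>\<omega>. W u \<omega> * \<epsilon> (a + Suc u) \<omega>) = 0" for u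
    using indep_var_lebesgue_integral[OF indep W_int int, of u] mean[of "a + Suc u"] by simp
  let ?R = "\<lambda>\<omega>. 4 * (\<Sum>i=a + 1..a + s. (\<epsilon> i \<omega>)\<^sup>2) + (\<Sum>u<s. W u \<omega> * \<epsilon> (a + Suc u) \<omega>)"
  have sq_int: "integrable M (\<lambda>\<omega>. 4 * (\<Sum>i=a + 1..a + s. (\<epsilon> i \<omega>)\<^sup>2))"
    using sq by (intro integrable_mult_right Bochner_Integration.integrable_sum) auto
  have R_int: "integrable M ?R"
    using sq_int prod_int by (intro Bochner_Integration.integrable_add Bochner_Integration.integrable_sum) auto
  have le: "(sup_partial (\<lambda>i. \<epsilon> i \<omega>) a s)\<^sup>2 \<le> ?R \<omega>" for \<omega>
    unfolding W_def by (rule pathwise_doob)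
  have [measurable]: "(\<lambda>\<omega>. sup_partial (\<lambda>i. \<epsilon> i \<omega>) a s) \<in> borel_measurable M"
    by (rule sup_partial_measurable) simp
  show ?int
    by (rule Bochner_Integration.integrable_bound[OF R_int]) (use le in \<open>auto intro: order_trans abs_ge_self\<close>)
  then have "expectation (\<lambda>\<omega>. (sup_partial (\<lambda>i. \<epsilon> i \<omega>) a s)\<^sup>2) \<le> expectation ?R"
    using R_int le by (intro integral_mono) auto
  also have "expectation ?R = expectation (\<lambda>\<omega>. 4 * (\<Sum>i=a + 1..a + s. (\<epsilon> i \<omega>)\<^sup>2))
      + expectation (\<lambda>\<omega>. \<Sum>u<s. W u \<omega> * \<epsilon> (a + Suc u) \<omega>)"
    using sq_int prod_int by (intro Bochner_Integration.integral_add Bochner_Integration.integrable_sum) auto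
  also have "expectation (\<lambda>\<omega>. \<Sum>u<s. W u \<omega> * \<epsilon> (a + Suc u) \<omega>) = 0"
    by (subst Bochner_Integration.integral_sum) (use prod_int prod_mean in auto)
  also have "expectation (\<lambda>\<omega>. 4 * (\<Sum>i=a + 1..a + s. (\<epsilon> i \<omega>)\<^sup>2)) = 4 * (\<Sum>i=a + 1..a + s. v)"
    by (simp only: integral_mult_right_zero, subst Bochner_Integration.integral_sum) (use sq var in auto)
  finally show ?le by simp
qed

lemma block_energy_expectation:
  fixes \<epsilon> :: "nat \<Rightarrow> 'a \<Rightarrow> real"
  assumes "indep_vars (\<lambda>_. borel) \<epsilon> {1..}"
    and "\<And>i. 1 \<le> i \<Longrightarrow> integrable M (\<lambda>\<omega>. (\<epsilon> i \<omega>)\<^sup>2)"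
    and "\<And>i. 1 \<le> i \<Longrightarrow> expectation (\<epsilon> i) = 0"
    and "\<And>i. 1 \<le> i \<Longrightarrow> expectation (\<lambda>\<omega>. (\<epsilon> i \<omega>)\<^sup>2) = v"
    and "0 < d" and "0 \<le> v"
  shows "integrable M (\<lambda>\<omega>. block_energy d n (\<lambda>i. \<epsilon> i \<omega>))"
    and "expectation (\<lambda>\<omega>. block_energy d n (\<lambda>i. \<epsilon> i \<omega>)) \<le> 48 * v * (n / d + 1)"
proof -
  note moment = sup_partial_second_moment[OF assms(1-4)]
  show "integrable M (\<lambda>\<omega>. block_energy d n (\<lambda>i. \<epsilon> i \<omega>))"
    unfolding block_energy_def
    by (intro integrable_mult_right Bochner_Integration.integrable_sum moment(1))
  have "expectation (\<lambda>\<omega>. block_energy d n (\<lambda>i. \<epsilon> i \<omega>))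
      = 12 / d * (\<Sum>j\<le>n div d. expectation (\<lambda>\<omega>. (sup_partial (\<lambda>i. \<epsilon> i \<omega>) (j * d) d)\<^sup>2))"
    unfolding block_energy_def
    by (simp only: integral_mult_right_zero, subst Bochner_Integration.integral_sum)
      (use moment(1) in auto)
  also have "\<dots> \<le> 12 / d * (\<Sum>j\<le>n div d. 4 * real d * v)"
    by (intro mult_left_mono sum_mono moment(2)) auto
  also have "\<dots> = 48 * v * (real (n div d) + 1)" using assms(5) by simp
  also have "\<dots> \<le> 48 * v * (n / d + 1)"
    using assms(6) by (intro mult_left_mono add_right_mono of_nat_div_le_of_nat) auto
  finally show "expectation (\<lambda>\<omega>. block_energy d n (\<lambda>i. \<epsilon> i \<omega>)) \<le> 48 * v * (n / d + 1)" .
qed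

lemma near_energy_expectation:
  fixes \<epsilon> :: "nat \<Rightarrow> 'a \<Rightarrow> real"
  assumes sq: "\<And>i. 1 \<le> i \<Longrightarrow> integrable M (\<lambda>\<omega>. (\<epsilon> i \<omega>)\<^sup>2)"
    and var: "\<And>i. 1 \<le> i \<Longrightarrow> expectation (\<lambda>\<omega>. (\<epsilon> i \<omega>)\<^sup>2) = v" and "0 \<le> v"
  shows "integrable M (\<lambda>\<omega>. near_energy s p q (\<lambda>i. \<epsilon> i \<omega>))"
    and "expectation (\<lambda>\<omega>. near_energy s p q (\<lambda>i. \<epsilon> i \<omega>)) \<le> (real p + 2) * (2 * real q * v)"
proof -
  have int: "integrable M (\<lambda>\<omega>. \<Sum>i=s l - q + 1..s l + q. (\<epsilon> i \<omega>)\<^sup>2)" for l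
    using sq by (intro Bochner_Integration.integrable_sum) auto
  show "integrable M (\<lambda>\<omega>. near_energy s p q (\<lambda>i. \<epsilon> i \<omega>))"
    unfolding near_energy_def by (intro Bochner_Integration.integrable_sum int)
  have "expectation (\<lambda>\<omega>. near_energy s p q (\<lambda>i. \<epsilon> i \<omega>))
      = (\<Sum>l\<le>p + 1. expectation (\<lambda>\<omega>. \<Sum>i=s l - q + 1..s l + q. (\<epsilon> i \<omega>)\<^sup>2))"
    unfolding near_energy_def by (subst Bochner_Integration.integral_sum) (use int in auto)
  also have "\<dots> = (\<Sum>l\<le>p + 1. \<Sum>i=s l - q + 1..s l + q. v)"
    by (intro sum.cong refl, subst Bochner_Integration.integral_sum) (use sq var in auto)
  also have "\<dots> \<le> (\<Sum>l\<le>p + 1. 2 * real q * v)"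
    using \<open>0 \<le> v\<close> by (intro sum_mono) (auto intro!: mult_right_mono)
  also have "\<dots> = (real p + 2) * (2 * real q * v)" by simp
  finally show "expectation (\<lambda>\<omega>. near_energy s p q (\<lambda>i. \<epsilon> i \<omega>)) \<le> (real p + 2) * (2 * real q * v)" .
qed

lemma lag_energy_expectation:
  fixes \<epsilon> :: "nat \<Rightarrow> 'a \<Rightarrow> real"
  assumes r: "\<bar>r\<bar> < 1" and n: "1 \<le> n"
    and x0: "integrable M (\<lambda>\<omega>. (x0 \<omega>)\<^sup>2)" "expectation (\<lambda>\<omega>. (x0 \<omega>)\<^sup>2) = E0"
    and sq: "\<And>i. 1 \<le> i \<Longrightarrow> integrable M (\<lambda>\<omega>. (\<epsilon> i \<omega>)\<^sup>2)"
    and var: "\<And>i. 1 \<le> i \<Longrightarrow> expectation (\<lambda>\<omega>. (\<epsilon> i \<omega>)\<^sup>2) = v"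
  shows "integrable M (\<lambda>\<omega>. lag_energy_bound r T n (x0 \<omega>) (\<lambda>i. \<epsilon> i \<omega>))"
    and "expectation (\<lambda>\<omega>. lag_energy_bound r T n (x0 \<omega>) (\<lambda>i. \<epsilon> i \<omega>))
      \<le> n * ((E0 + (2 * T + 2 * v) / (1 - \<bar>r\<bar>)) / (1 - \<bar>r\<bar>))"
proof -
  have int: "integrable M (\<lambda>\<omega>. 2 * T + 2 * (\<epsilon> i \<omega>)\<^sup>2)" if "i \<in> {1..n}" for i
    using sq that by auto
  have sum_int: "integrable M (\<lambda>\<omega>. (\<Sum>i=1..n. 2 * T + 2 * (\<epsilon> i \<omega>)\<^sup>2) / (1 - \<bar>r\<bar>))"
    using int by (intro integrable_divide_zero Bochner_Integration.integrable_sum) auto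
  show "integrable M (\<lambda>\<omega>. lag_energy_bound r T n (x0 \<omega>) (\<lambda>i. \<epsilon> i \<omega>))"
    unfolding lag_energy_bound_def using x0 sum_int by auto
  have E0: "0 \<le> E0" unfolding x0(2)[symmetric] by simp
  have "expectation (\<lambda>\<omega>. lag_energy_bound r T n (x0 \<omega>) (\<lambda>i. \<epsilon> i \<omega>))
      = (E0 + expectation (\<lambda>\<omega>. \<Sum>i=1..n. 2 * T + 2 * (\<epsilon> i \<omega>)\<^sup>2) / (1 - \<bar>r\<bar>)) / (1 - \<bar>r\<bar>)"
    unfolding lag_energy_bound_def using x0 sum_int by simp
  also have "expectation (\<lambda>\<omega>. \<Sum>i=1..n. 2 * T + 2 * (\<epsilon> i \<omega>)\<^sup>2) = (\<Sum>i=1..n. 2 * T + 2 * v)"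
    by (subst Bochner_Integration.integral_sum) (use int sq var in \<open>auto simp: prob_space\<close>)
  also have "(E0 + (\<Sum>i=1..n. 2 * T + 2 * v) / (1 - \<bar>r\<bar>)) / (1 - \<bar>r\<bar>)
      \<le> (n * E0 + (\<Sum>i=1..n. 2 * T + 2 * v) / (1 - \<bar>r\<bar>)) / (1 - \<bar>r\<bar>)"
    using r n E0 mult_right_mono[of 1 "real n" E0] by (intro divide_right_mono) auto
  also have "\<dots> = n * ((E0 + (2 * T + 2 * v) / (1 - \<bar>r\<bar>)) / (1 - \<bar>r\<bar>))"
    by (simp add: algebra_simps)
  finally show "expectation (\<lambda>\<omega>. lag_energy_bound r T n (x0 \<omega>) (\<lambda>i. \<epsilon> i \<omega>))
      \<le> n * ((E0 + (2 * T + 2 * v) / (1 - \<bar>r\<bar>)) / (1 - \<bar>r\<bar>))" .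
qed

lemma noise_moments:
  assumes "second_order_noise M \<epsilon> z0 m0 \<rho> \<sigma>"
  shows "indep_vars (\<lambda>_. borel) \<epsilon> {1..}"
    and "1 \<le> i \<Longrightarrow> integrable M (\<lambda>\<omega>. (\<epsilon> i \<omega>)\<^sup>2)"
    and "1 \<le> i \<Longrightarrow> expectation (\<epsilon> i) = 0"
    and "1 \<le> i \<Longrightarrow> expectation (\<lambda>\<omega>. (\<epsilon> i \<omega>)\<^sup>2) = \<sigma>\<^sup>2"
    and "1 \<le> n \<Longrightarrow> integrable M (\<lambda>\<omega>. (z0 n \<omega>)\<^sup>2)"
    and "1 \<le> n \<Longrightarrow> expectation (\<lambda>\<omega>. (z0 n \<omega>)\<^sup>2) = m0\<^sup>2 + \<sigma>\<^sup>2 / (1 - \<rho>\<^sup>2)"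
proof -
  have eps: "\<epsilon> i \<in> borel_measurable M \<and> integrable M (\<lambda>\<omega>. (\<epsilon> i \<omega>)\<^sup>2) \<and>
      expectation (\<epsilon> i) = 0 \<and> variance (\<epsilon> i) = \<sigma>\<^sup>2" if "1 \<le> i" for i
    using assms that unfolding second_order_noise_def by blast
  have z0: "z0 n \<in> borel_measurable M \<and> integrable M (\<lambda>\<omega>. (z0 n \<omega>)\<^sup>2) \<and>
      expectation (z0 n) = m0 \<and> variance (z0 n) = \<sigma>\<^sup>2 / (1 - \<rho>\<^sup>2)" if "1 \<le> n" for n
    using assms that unfolding second_order_noise_def by blast
  show "indep_vars (\<lambda>_. borel) \<epsilon> {1..}"
    using assms unfolding second_order_noise_def by blast
  show "1 \<le> i \<Longrightarrow> integrable M (\<lambda>\<omega>. (\<epsilon> i \<omega>)\<^sup>2)" "1 \<le> i \<Longrightarrow> expectation (\<epsilon> i) = 0"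
    "1 \<le> n \<Longrightarrow> integrable M (\<lambda>\<omega>. (z0 n \<omega>)\<^sup>2)"
    using eps z0 by blast+
  show "expectation (\<lambda>\<omega>. (\<epsilon> i \<omega>)\<^sup>2) = \<sigma>\<^sup>2" if "1 \<le> i"
  proof -
    have "expectation (\<epsilon> i) = 0" "variance (\<epsilon> i) = \<sigma>\<^sup>2" using eps[OF that] by blast+
    then show ?thesis by (simp only: diff_0_right)
  qed
  show "expectation (\<lambda>\<omega>. (z0 n \<omega>)\<^sup>2) = m0\<^sup>2 + \<sigma>\<^sup>2 / (1 - \<rho>\<^sup>2)" if "1 \<le> n"
  proof -
    have "integrable M (z0 n)"
      using z0[OF that] square_integrable_imp_integrable by blast
    moreover have "integrable M (\<lambda>\<omega>. (z0 n \<omega>)\<^sup>2)" "expectation (z0 n) = m0"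
      "variance (z0 n) = \<sigma>\<^sup>2 / (1 - \<rho>\<^sup>2)"
      using z0[OF that] by blast+
    ultimately show ?thesis using variance_eq[of "z0 n"] by (simp only:)
  qed
qed

end

text \<open>All stochastic terms of the selection lemma in one variable, so that a single application of
Markov's inequality suffices. The factor \<open>c\<close> stands for a bound on the squared error of an
estimate of \<open>r\<close>, the autoregressive coefficient.\<close>

definition perturbation ::
    "nat \<Rightarrow> nat \<Rightarrow> (nat \<Rightarrow> nat) \<Rightarrow> nat \<Rightarrow> real \<Rightarrow> real \<Rightarrow> real \<Rightarrow> nat \<Rightarrow> real \<Rightarrow> (nat \<Rightarrow> real) \<Rightarrow> real" where
  "perturbation d q s p c r T n x0 \<epsilon> = block_energy d n \<epsilon> + block_energy q n \<epsilon>
    + near_energy s p q \<epsilon> + c * lag_energy_bound r T n x0 \<epsilon>"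

lemma (in prob_space) perturbation_expectation:
  assumes noise: "second_order_noise M \<epsilon> z0 m0 \<rho> \<sigma>"
    and "\<bar>\<rho>\<bar> < 1" "0 < d" "0 < q" "1 \<le> n" "0 \<le> c"
  shows "integrable M (\<lambda>\<omega>. perturbation d q s p c \<rho> T n (z0 n \<omega>) (\<lambda>i. \<epsilon> i \<omega>))"
    and "expectation (\<lambda>\<omega>. perturbation d q s p c \<rho> T n (z0 n \<omega>) (\<lambda>i. \<epsilon> i \<omega>))
      \<le> 48 * \<sigma>\<^sup>2 * (n / d + 1) + 48 * \<sigma>\<^sup>2 * (n / q + 1) + (real p + 2) * (2 * real q * \<sigma>\<^sup>2)
        + c * (n * ((m0\<^sup>2 + \<sigma>\<^sup>2 / (1 - \<rho>\<^sup>2) + (2 * T + 2 * \<sigma>\<^sup>2) / (1 - \<bar>\<rho>\<bar>)) / (1 - \<bar>\<rho>\<bar>)))"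
proof -
  note moments = noise_moments[OF noise]
  have nn: "0 \<le> \<sigma>\<^sup>2" by simp
  note block = block_energy_expectation[OF moments(1-4) _ nn]
    and near = near_energy_expectation[OF moments(2,4) nn, where s = s and p = p and q = q]
    and lag = lag_energy_expectation[OF \<open>\<bar>\<rho>\<bar> < 1\<close> \<open>1 \<le> n\<close> moments(5,6)[OF \<open>1 \<le> n\<close>] moments(2,4), where T = T]
  note [simp] = block(1)[OF _ _ _ \<open>0 < d\<close>] block(1)[OF _ _ _ \<open>0 < q\<close>] near(1) lag(1)
  show "integrable M (\<lambda>\<omega>. perturbation d q s p c \<rho> T n (z0 n \<omega>) (\<lambda>i. \<epsilon> i \<omega>))"
    unfolding perturbation_def by simp
  let ?e = "\<lambda>\<omega> i. \<epsilon> i \<omega>"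
  have "expectation (\<lambda>\<omega>. perturbation d q s p c \<rho> T n (z0 n \<omega>) (?e \<omega>))
      = expectation (\<lambda>\<omega>. block_energy d n (?e \<omega>)) + expectation (\<lambda>\<omega>. block_energy q n (?e \<omega>))
        + expectation (\<lambda>\<omega>. near_energy s p q (?e \<omega>))
        + c * expectation (\<lambda>\<omega>. lag_energy_bound \<rho> T n (z0 n \<omega>) (?e \<omega>))"
    unfolding perturbation_def by simp
  also have "\<dots> \<le> 48 * \<sigma>\<^sup>2 * (n / d + 1) + 48 * \<sigma>\<^sup>2 * (n / q + 1) + (real p + 2) * (2 * real q * \<sigma>\<^sup>2)
        + c * (n * ((m0\<^sup>2 + \<sigma>\<^sup>2 / (1 - \<rho>\<^sup>2) + (2 * T + 2 * \<sigma>\<^sup>2) / (1 - \<bar>\<rho>\<bar>)) / (1 - \<bar>\<rho>\<bar>)))"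
    using assms by (intro add_mono block(2) near(2) mult_left_mono lag(2)) auto
  finally show "expectation (\<lambda>\<omega>. perturbation d q s p c \<rho> T n (z0 n \<omega>) (?e \<omega>)) \<le> \<dots>" .
qed

text \<open>The numerator is the bound on the expected perturbation for the block lengths \<open>\<Delta> n\<close> and \<open>sqrt n\<close>,
rounded up. Up to constants it is at most \<open>n / \<Delta> n + sqrt n\<close>; division by \<open>n * \<beta> n\<close> turns the
two terms into \<open>1 / (\<Delta> n * \<beta> n)\<close> and \<open>1 / (sqrt n * \<beta> n)\<close>.\<close>

lemma perturbation_rate:
  fixes \<beta> \<Delta> :: "nat \<Rightarrow> real" and A B C :: real
  assumes pos: "\<And>n. n \<ge> 1 \<Longrightarrow> \<beta> n > 0"
    and root: "filterlim (\<lambda>n. real n powr (1/2) * \<beta> n) at_top sequentially"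
    and gap: "filterlim (\<lambda>n. \<Delta> n * \<beta> n) at_top sequentially"
    and "0 \<le> A" "0 \<le> B"
  shows "(\<lambda>n. (A * (n / nat \<lceil>\<Delta> n\<rceil> + 1) + A * (n / nat \<lceil>sqrt n\<rceil> + 1) + B * real (nat \<lceil>sqrt n\<rceil>) + C)
      / (n * \<beta> n)) \<longlonglongrightarrow> 0"
proof -
  let ?g = "\<lambda>n. A * inverse (\<Delta> n * \<beta> n) + (3 * A + 2 * B + \<bar>C\<bar>) * inverse (real n powr (1/2) * \<beta> n)"
  have "?g \<longlonglongrightarrow> A * 0 + (3 * A + 2 * B + \<bar>C\<bar>) * 0"
    by (intro tendsto_intros tendsto_inverse_0_at_top root gap)
  then have g: "?g \<longlonglongrightarrow> 0" by simp
  let ?h = "\<lambda>n. - \<bar>C\<bar> * inverse (real n powr (1/2) * \<beta> n)"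
  have "?h \<longlonglongrightarrow> - \<bar>C\<bar> * 0"
    by (intro tendsto_intros tendsto_inverse_0_at_top root)
  then have h: "?h \<longlonglongrightarrow> 0" by simp
  have ev: "eventually (\<lambda>n. 0 < \<Delta> n * \<beta> n \<and> 1 \<le> n) sequentially"
    using gap eventually_ge_at_top[of 1]
    by (intro eventually_conj) (auto simp: filterlim_at_top_dense)
  have bounds: "A * (n / nat \<lceil>\<Delta> n\<rceil> + 1) + A * (n / nat \<lceil>sqrt n\<rceil> + 1) + B * real (nat \<lceil>sqrt n\<rceil>) + C
        \<le> A * (n / \<Delta> n) + (3 * A + 2 * B + \<bar>C\<bar>) * sqrt n \<and>
      - \<bar>C\<bar> * sqrt n \<le> A * (n / nat \<lceil>\<Delta> n\<rceil> + 1) + A * (n / nat \<lceil>sqrt n\<rceil> + 1) + B * real (nat \<lceil>sqrt n\<rceil>) + C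
      \<and> 0 < \<Delta> n"
    if n: "0 < \<Delta> n * \<beta> n \<and> 1 \<le> n" for n
  proof -
    have D: "0 < \<Delta> n" using n pos[of n] by (simp add: zero_less_mult_iff)
    have r: "1 \<le> sqrt n" using n by simp
    have "n / nat \<lceil>\<Delta> n\<rceil> \<le> n / \<Delta> n"
      using D by (intro divide_left_mono mult_pos_pos real_nat_ceiling_ge) auto
    then have 1: "A * (n / nat \<lceil>\<Delta> n\<rceil>) \<le> A * (n / \<Delta> n)" using \<open>0 \<le> A\<close> by (rule mult_left_mono)
    have "n / nat \<lceil>sqrt n\<rceil> \<le> n / sqrt n"
      using n by (intro divide_left_mono mult_pos_pos real_nat_ceiling_ge) auto
    also have "\<dots> = sqrt n" by (simp add: real_div_sqrt)
    finally have 2: "A * (n / nat \<lceil>sqrt n\<rceil>) \<le> A * sqrt n" using \<open>0 \<le> A\<close> by (rule mult_left_mono)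
    have "real (nat \<lceil>sqrt n\<rceil>) \<le> 2 * sqrt n" using r by linarith
    then have 3: "B * real (nat \<lceil>sqrt n\<rceil>) \<le> B * (2 * sqrt n)" using \<open>0 \<le> B\<close> by (rule mult_left_mono)
    have 4: "2 * A \<le> 2 * A * sqrt n" "\<bar>C\<bar> \<le> \<bar>C\<bar> * sqrt n"
      using r \<open>0 \<le> A\<close> mult_left_mono[of 1 "sqrt n" "2 * A"] mult_left_mono[of 1 "sqrt n" "\<bar>C\<bar>"] by auto
    have 5: "0 \<le> A * (n / nat \<lceil>\<Delta> n\<rceil>)" "0 \<le> A * (n / nat \<lceil>sqrt n\<rceil>)" "0 \<le> B * real (nat \<lceil>sqrt n\<rceil>)"
      by (intro mult_nonneg_nonneg divide_nonneg_nonneg of_nat_0_le_iff \<open>0 \<le> A\<close> \<open>0 \<le> B\<close>)+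
    have 6: "A * (u + 1) = A * u + A" for u by (simp add: distrib_left)
    have 7: "(3 * A + 2 * B + \<bar>C\<bar>) * sqrt n = 3 * (A * sqrt n) + 2 * (B * sqrt n) + \<bar>C\<bar> * sqrt n"
      by (simp add: distrib_right)
    have 8: "- \<bar>C\<bar> * sqrt n = - (\<bar>C\<bar> * sqrt n)" "2 * A * sqrt n = 2 * (A * sqrt n)"
      "B * (2 * sqrt n) = 2 * (B * sqrt n)" by simp_all
    show ?thesis
      unfolding 6 7 8(1)
      using 1 2 3[unfolded 8(3)] 4[unfolded 8(2)] 5 D \<open>0 \<le> A\<close> abs_ge_self[of C] abs_ge_minus_self[of C]
      by (intro conjI) linarith+
  qed
  have conv: "A * (n / \<Delta> n) / (n * \<beta> n) = A * inverse (\<Delta> n * \<beta> n)"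
      "K * sqrt n / (n * \<beta> n) = K * inverse (real n powr (1/2) * \<beta> n)"
    if "0 < \<Delta> n * \<beta> n \<and> 1 \<le> n" for n and K :: real
  proof -
    have "sqrt n * sqrt n = n" by simp
    then have "K * sqrt n / (n * \<beta> n) = K * sqrt n / (sqrt n * sqrt n * \<beta> n)" by simp
    also have "\<dots> = K * inverse (sqrt n * \<beta> n)"
      using that pos[of n] by (simp add: field_simps)
    finally show "K * sqrt n / (n * \<beta> n) = K * inverse (real n powr (1/2) * \<beta> n)"
      by (simp add: powr_half_sqrt)
    show "A * (n / \<Delta> n) / (n * \<beta> n) = A * inverse (\<Delta> n * \<beta> n)"
      using that by (simp add: field_simps)
  qed
  have le_g: "\<forall>\<^sub>F n in sequentially. (A * (n / nat \<lceil>\<Delta> n\<rceil> + 1) + A * (n / nat \<lceil>sqrt n\<rceil> + 1) + B * real (nat \<lceil>sqrt n\<rceil>) + C)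
      / (n * \<beta> n) \<le> ?g n"
    using ev
  proof eventually_elim
    case (elim n)
    have "(A * (n / nat \<lceil>\<Delta> n\<rceil> + 1) + A * (n / nat \<lceil>sqrt n\<rceil> + 1) + B * real (nat \<lceil>sqrt n\<rceil>) + C) / (n * \<beta> n)
        \<le> (A * (n / \<Delta> n) + (3 * A + 2 * B + \<bar>C\<bar>) * sqrt n) / (n * \<beta> n)"
      using bounds[OF elim] elim pos[of n] by (intro divide_right_mono) auto
    then show ?case using conv[OF elim] by (simp only: add_divide_distrib)
  qed
  have h_le: "\<forall>\<^sub>F n in sequentially. ?h n \<le> (A * (n / nat \<lceil>\<Delta> n\<rceil> + 1) + A * (n / nat \<lceil>sqrt n\<rceil> + 1) + B * real (nat \<lceil>sqrt n\<rceil>) + C)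
      / (n * \<beta> n)"
    using ev
  proof eventually_elim
    case (elim n)
    have "- \<bar>C\<bar> * sqrt n / (n * \<beta> n) \<le> (A * (n / nat \<lceil>\<Delta> n\<rceil> + 1) + A * (n / nat \<lceil>sqrt n\<rceil> + 1)
        + B * real (nat \<lceil>sqrt n\<rceil>) + C) / (n * \<beta> n)"
      using bounds[OF elim] elim pos[of n] by (intro divide_right_mono) auto
    then show ?case using conv(2)[OF elim, of "- \<bar>C\<bar>"] by simp
  qed
  show ?thesis by (rule real_tendsto_sandwich[OF h_le le_g h g])
qed

section \<open>Consistency of the selected number of change-points\<close>

lemma change_point_gap:
  assumes "0 \<le> \<tau> k" "\<tau> k \<le> \<tau> (k + 1)"
  shows "real n * (\<tau> (k + 1) - \<tau> k) - 1 \<le> real (change_point \<tau> n (k + 1)) - real (change_point \<tau> n k)"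
proof -
  have "0 \<le> real n * \<tau> k" "0 \<le> real n * \<tau> (k + 1)" using assms by auto
  then have "real (change_point \<tau> n k) = of_int \<lfloor>real n * \<tau> k\<rfloor>"
    "real (change_point \<tau> n (k + 1)) = of_int \<lfloor>real n * \<tau> (k + 1)\<rfloor>"
    by (simp_all add: change_point_def)
  then show ?thesis by (simp only: right_diff_distrib) linarith
qed

lemma finite_positive_bounded_below:
  fixes f :: "nat \<Rightarrow> real"
  assumes "\<And>k. k < p \<Longrightarrow> 0 < f k"
  obtains c where "0 < c" "\<And>k. k < p \<Longrightarrow> c \<le> f k"
proof -
  have "\<exists>c>0. \<forall>k<p. c \<le> f k"
    using assms
  proof (induction p)
    case (Suc p)
    then obtain c where "0 < c" "\<forall>k<p. c \<le> f k" by auto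
    then show ?case using Suc.prems[of p]
      by (intro exI[of _ "min c (f p)"]) (auto simp: less_Suc_eq min_le_iff_disj)
  qed (auto intro: exI[of _ 1])
  then show thesis using that by blast
qed

theorem proposition4:
  fixes M :: "'a measure"
    and m_star m_max :: nat
    and \<tau> \<mu> :: "nat \<Rightarrow> real"
    and \<rho> \<sigma> \<alpha> :: real
    and \<epsilon> :: "nat \<Rightarrow> 'a \<Rightarrow> real"
    and z :: "nat \<Rightarrow> nat \<Rightarrow> 'a \<Rightarrow> real"
    and \<rho>_bar :: "nat \<Rightarrow> 'a \<Rightarrow> real"
    and \<Delta> \<beta> :: "nat \<Rightarrow> real"
    and m_hat :: "nat \<Rightarrow> 'a \<Rightarrow> nat"
  assumes "prob_space M"
    and "\<tau> 0 = 0" and "\<tau> (m_star + 1) = 1" and "\<And>k. k \<le> m_star \<Longrightarrow> \<tau> k < \<tau> (k + 1)"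
    and "\<And>k. 1 \<le> k \<Longrightarrow> k \<le> m_star \<Longrightarrow> \<mu> k \<noteq> \<mu> (k - 1)"
    and "\<bar>\<rho>\<bar> < 1" and "\<sigma> > 0"
    and "\<And>n. n \<ge> 1 \<Longrightarrow> ar1_change_model M m_star \<tau> \<mu> \<rho> \<epsilon> n (z n)"
    and "\<And>n. n \<ge> 1 \<Longrightarrow> \<rho>_bar n \<in> borel_measurable M"
    and "bounded_in_prob M (\<lambda>n \<omega>. \<rho>_bar n \<omega> - \<rho>) (\<lambda>n. real n powr (-1/2))"
    and "(\<lambda>n. \<Delta> n / real n) \<longlonglongrightarrow> 0"
    and "\<alpha> > 0" and "filterlim (\<lambda>n. real n powr (-\<alpha>) * \<Delta> n) at_top sequentially"
    and "m_star \<le> m_max"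
    and "\<And>n. n \<ge> 1 \<Longrightarrow> \<beta> n > 0"
    and "\<beta> \<longlonglongrightarrow> 0"
    and "filterlim (\<lambda>n. real n powr (1/2) * \<beta> n) at_top sequentially"
    and "filterlim (\<lambda>n. \<Delta> n * \<beta> n) at_top sequentially"
    and "\<And>n. n \<ge> 1 \<Longrightarrow> m_hat n \<in> measurable M (count_space UNIV)"
    and "\<And>n \<omega>. n \<ge> 1 \<Longrightarrow> (\<forall>m\<le>m_max. admissible \<Delta> n m \<noteq> {}) \<Longrightarrow> \<omega> \<in> space M \<Longrightarrow>
           is_arg_min (\<lambda>m. SS \<Delta> n m (\<lambda>i. z n i \<omega>) (\<rho>_bar n \<omega>) / real n + \<beta> n * real m)
             (\<lambda>m. m \<le> m_max) (m_hat n \<omega>)"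
  shows "(gaussian_noise M \<epsilon> (\<lambda>n. z n 0) (\<mu> 0) \<rho> \<sigma> \<longrightarrow>
           tendsto_in_prob M (\<lambda>n \<omega>. real (m_hat n \<omega>)) (real m_star)) \<and>
         (second_order_noise M \<epsilon> (\<lambda>n. z n 0) (\<mu> 0) \<rho> \<sigma> \<longrightarrow>
           tendsto_in_prob M (\<lambda>n \<omega>. real (m_hat n \<omega>)) (real m_star))"
proof -
  interpret prob_space M by fact
  note \<tau> = assms(2-4) and \<mu> = assms(5) and \<rho> = assms(6) and model = assms(8)
    and \<rho>_bar_meas = assms(9) and \<rho>_bar = assms(10) and \<Delta>_small = assms(11) and le_max = assms(14)
    and \<beta>_pos = assms(15) and \<beta>_0 = assms(16) and \<beta>_root = assms(17) and \<beta>_gap = assms(18)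
    and m_hat = assms(20)
  let ?p = m_star
  define \<theta> where "\<theta> l = (1 - \<rho>) * \<mu> l" for l
  define T where "T = (\<Sum>l\<le>?p. (\<theta> l)\<^sup>2)"
  have T: "(\<theta> l)\<^sup>2 \<le> T" if "l \<le> ?p" for l
    unfolding T_def using that by (intro member_le_sum) auto
  obtain \<kappa> where \<kappa>: "0 < \<kappa>" "\<And>l. l < ?p \<Longrightarrow> \<kappa> \<le> (\<theta> (l + 1) - \<theta> l)\<^sup>2"
  proof (rule finite_positive_bounded_below[of ?p "\<lambda>l. (\<theta> (l + 1) - \<theta> l)\<^sup>2"])
    fix l assume "l < ?p"
    then have "\<mu> (l + 1) \<noteq> \<mu> l" using \<mu>[of "l + 1"] by simp
    then show "0 < (\<theta> (l + 1) - \<theta> l)\<^sup>2"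
      using \<rho> by (auto simp: \<theta>_def)
  qed blast
  obtain \<gamma> where \<gamma>: "0 < \<gamma>" "\<And>l. l < ?p + 1 \<Longrightarrow> \<gamma> \<le> \<tau> (l + 1) - \<tau> l"
    by (rule finite_positive_bounded_below[of "?p + 1" "\<lambda>l. \<tau> (l + 1) - \<tau> l"]) (use \<tau>(3) in auto)
  have \<tau>_nonneg: "0 \<le> \<tau> l" if "l \<le> ?p + 1" for l
    using that
  proof (induction l)
    case (Suc l) then show ?case using \<tau>(3)[of l] by simp
  qed (simp add: \<tau>)
  define s where "s n = change_point \<tau> n" for n
  have s0: "s n 0 = 0" and s1: "s n (?p + 1) = n" for n
    using \<tau>(1,2) by (auto simp: s_def change_point_def)
  have s_gap: "n * \<gamma> - 1 \<le> real (s n (l + 1)) - real (s n l)" if "l \<le> ?p" for n l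
  proof -
    have "n * \<gamma> \<le> n * (\<tau> (l + 1) - \<tau> l)" using \<gamma>(2)[of l] that by (intro mult_left_mono) auto
    then show ?thesis
      using change_point_gap[of \<tau> l n] \<tau>_nonneg[of l] \<tau>(3)[of l] that unfolding s_def by simp
  qed
  have s_model: "z n i \<omega> - \<rho> * z n (i - 1) \<omega> = \<theta> l + \<epsilon> i \<omega>"
    if "1 \<le> n" "\<omega> \<in> space M" "l \<le> ?p" "i \<in> {s n l + 1..s n (l + 1)}" for n \<omega> l i
  proof -
    have "z n i \<omega> - \<mu> l = \<rho> * (z n (i - 1) \<omega> - \<mu> l) + \<epsilon> i \<omega>"
      using model[OF that(1)] that unfolding ar1_change_model_def s_def by blast
    then show ?thesis by (simp add: \<theta>_def algebra_simps)
  qed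
  \<comment> \<open>A quarter of a lower bound for the segment lengths: windows of radius \<open>h n\<close> around the change-points
    are disjoint, and the factor 1/4 rather than 1/2 absorbs the rounding of the change-points.\<close>
  define h where "h n = nat \<lfloor>n * \<gamma> / 4\<rfloor>" for n :: nat
  define d where "d n = nat \<lceil>\<Delta> n\<rceil>" for n
  \<comment> \<open>Any scale with both \<open>q n\<close> and \<open>n / q n\<close> of smaller order than \<open>n * \<beta> n\<close> would do.\<close>
  define q where "q n = nat \<lceil>sqrt (real n)\<rceil>" for n :: nat
  define good where "good n \<longleftrightarrow> 1 \<le> n \<and> 0 < \<Delta> n \<and> s n \<in> admissible \<Delta> n ?p
      \<and> (\<forall>l\<le>?p. s n l + 2 * h n \<le> s n (l + 1)) \<and> (\<forall>m\<le>m_max. admissible \<Delta> n m \<noteq> {})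
      \<and> n * \<beta> n * (real ?p + 1) \<le> h n * \<kappa> / 4" for n
  have good: "eventually good sequentially"
  proof -
    let ?K = "real m_max + 1"
    have "eventually (\<lambda>n. \<Delta> n / real n < min (\<gamma> / 2) (1 / (2 * ?K))) sequentially"
      using \<Delta>_small by (rule order_tendstoD(2)) (use \<gamma>(1) in auto)
    moreover have "eventually (\<lambda>n. \<beta> n < \<gamma> * \<kappa> / (32 * (real ?p + 1))) sequentially"
      using \<beta>_0 by (rule order_tendstoD(2)) (use \<gamma>(1) \<kappa>(1) in auto)
    moreover have "eventually (\<lambda>n. max 1 (max (2 * ?K) (8 / \<gamma>)) \<le> real n) sequentially"
      using filterlim_real_sequentially unfolding filterlim_at_top by blast
    moreover have "eventually (\<lambda>n. 0 < \<Delta> n * \<beta> n) sequentially"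
      using \<beta>_gap by (simp add: filterlim_at_top_dense)
    ultimately show ?thesis
    proof eventually_elim
      case (elim n)
      have n: "1 \<le> n" "2 * ?K \<le> n" "8 \<le> n * \<gamma>"
        using elim(3) \<gamma>(1) by (auto simp: field_simps)
      have \<Delta>: "\<Delta> n \<le> n * \<gamma> / 2" "\<Delta> n \<le> n / (2 * ?K)"
        using elim(1) n(1) by (auto simp: field_simps)
      have \<Delta>_pos: "0 < \<Delta> n" using elim(4) \<beta>_pos[OF n(1)] by (simp add: zero_less_mult_iff)
      have gap: "s n l < s n (l + 1)" "\<Delta> n \<le> real (s n (l + 1)) - real (s n l)"
        "s n l + 2 * h n \<le> s n (l + 1)" if "l \<le> ?p" for l
      proof -
        have g: "n * \<gamma> / 2 \<le> real (s n (l + 1)) - real (s n l)"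
          using s_gap[OF that, of n] n(3) by linarith
        then show "s n l < s n (l + 1)" "\<Delta> n \<le> real (s n (l + 1)) - real (s n l)"
          using \<Delta> \<Delta>_pos n(3) by linarith+
        have "real (h n) \<le> n * \<gamma> / 4" unfolding h_def using n(3) by linarith
        then show "s n l + 2 * h n \<le> s n (l + 1)" using g by linarith
      qed
      have adm: "s n \<in> admissible \<Delta> n ?p"
        unfolding admissible_def
      proof (intro CollectI conjI ballI)
        fix k assume "k \<in> {1..?p + 1}"
        then obtain l where "k = l + 1" "l \<le> ?p" by (cases k) auto
        then show "s n (k - 1) < s n k" "\<Delta> n \<le> real (s n k) - real (s n (k - 1))"
          using gap[of l] by auto
      qed (rule s0 s1)+
      have "n < (m_max + 1) * (n div (m_max + 1)) + (m_max + 1)"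
        using dividend_less_div_times[of "m_max + 1" n] by (simp add: mult.commute)
      then have "real n < ?K * real (n div (m_max + 1)) + ?K"
        using of_nat_less_iff[of n "(m_max + 1) * (n div (m_max + 1)) + (m_max + 1)", where 'a = real]
        by (simp add: algebra_simps)
      moreover have half: "u / 2 \<le> v" if "u < v + k" "2 * k \<le> u" for u v k :: real
        using that by linarith
      ultimately have "real n / 2 \<le> ?K * real (n div (m_max + 1))" using n(2) by (intro half)
      then have g: "real n / (2 * ?K) \<le> real (n div (m_max + 1))"
        by (simp add: field_simps)
      moreover have "0 < real n / (2 * ?K)" using n(1) by simp
      ultimately have "0 < real (n div (m_max + 1))" by linarith
      then have ne: "admissible \<Delta> n m \<noteq> {}" if "m \<le> m_max" for m
        using that g \<Delta>(2) by (intro admissible_nonempty) auto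
      have "n * \<gamma> / 8 \<le> h n" unfolding h_def using n(3) by linarith
      then have "n * \<gamma> / 8 * (\<kappa> / 4) \<le> h n * (\<kappa> / 4)" using \<kappa>(1) by (intro mult_right_mono) auto
      moreover have "n * (\<beta> n * (real ?p + 1)) \<le> n * (\<gamma> * \<kappa> / 32)"
        using elim(2) by (intro mult_left_mono) (auto simp: field_simps)
      ultimately have "n * \<beta> n * (real ?p + 1) \<le> h n * \<kappa> / 4" by (simp add: algebra_simps)
      then show ?case
        unfolding good_def using n(1) \<Delta>_pos adm gap(3) ne by blast
    qed
  qed
  have main: "tendsto_in_prob M (\<lambda>n \<omega>. real (m_hat n \<omega>)) (real ?p)"
    if noise: "second_order_noise M \<epsilon> (\<lambda>n. z n 0) (\<mu> 0) \<rho> \<sigma>"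
    unfolding tendsto_in_prob_def
  proof (intro allI impI)
    fix e :: real assume "0 < e"
    let ?bad = "\<lambda>n. {\<omega> \<in> space M. e < \<bar>real (m_hat n \<omega>) - real ?p\<bar>}"
    show "(\<lambda>n. prob (?bad n)) \<longlonglongrightarrow> 0"
    proof (rule order_tendstoI)
      fix a :: real assume "0 < a"
      then obtain C where C: "\<forall>\<^sub>F n in sequentially.
          prob {\<omega> \<in> space M. C * real n powr (-1/2) < \<bar>\<rho>_bar n \<omega> - \<rho>\<bar>} < a / 2"
        using \<rho>_bar unfolding bounded_in_prob_def by (meson half_gt_zero)
      \<comment> \<open>The expectation of \<open>V n\<close> is at most \<open>R n\<close>, and \<open>V n < n * \<beta> n / \<eta>\<close> is the noise condition
        of the selection lemma, given that \<open>(\<rho>_bar n - \<rho>)\<^sup>2 \<le> C\<^sup>2 / n\<close>.\<close>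
      define V where "V n \<omega> = perturbation (d n) (q n) (s n) ?p (C\<^sup>2 / n) \<rho> T n (z n 0 \<omega>) (\<lambda>i. \<epsilon> i \<omega>)" for n \<omega>
      define \<eta> where "\<eta> = 4 * (real m_max + 1) * (real ?p + 1)"
      define D where "D = ((\<mu> 0)\<^sup>2 + \<sigma>\<^sup>2 / (1 - \<rho>\<^sup>2) + (2 * T + 2 * \<sigma>\<^sup>2) / (1 - \<bar>\<rho>\<bar>)) / (1 - \<bar>\<rho>\<bar>)"
      define R where "R n = 48 * \<sigma>\<^sup>2 * (n / nat \<lceil>\<Delta> n\<rceil> + 1) + 48 * \<sigma>\<^sup>2 * (n / nat \<lceil>sqrt n\<rceil> + 1)
          + (2 * (real ?p + 2) * \<sigma>\<^sup>2) * real (nat \<lceil>sqrt n\<rceil>) + C\<^sup>2 * D" for n :: nat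
      have "(\<lambda>n. R n / (n * \<beta> n)) \<longlonglongrightarrow> 0"
        unfolding R_def by (rule perturbation_rate[OF \<beta>_pos \<beta>_root \<beta>_gap]) auto
      then have "(\<lambda>n. \<eta> * (R n / (n * \<beta> n))) \<longlonglongrightarrow> \<eta> * 0" by (intro tendsto_intros)
      then have "\<forall>\<^sub>F n in sequentially. \<eta> * (R n / (n * \<beta> n)) < a / 2"
        using \<open>0 < a\<close> by (intro order_tendstoD(2)[where y = "\<eta> * 0"]) auto
      with C good show "\<forall>\<^sub>F n in sequentially. prob (?bad n) < a"
      proof eventually_elim
        case (elim n)
        have n: "1 \<le> n" and \<Delta>: "0 < \<Delta> n" and adm: "s n \<in> admissible \<Delta> n ?p"
          and h: "\<And>l. l \<le> ?p \<Longrightarrow> s n l + 2 * h n \<le> s n (l + 1)"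
          and ne: "\<And>m. m \<le> m_max \<Longrightarrow> admissible \<Delta> n m \<noteq> {}"
          and signal: "n * \<beta> n * (real ?p + 1) \<le> h n * \<kappa> / 4"
          using elim(2) unfolding good_def by auto
        have dq: "0 < d n" "0 < q n" using \<Delta> n by (auto simp: d_def q_def)
        have V: "integrable M (V n)" "expectation (V n) \<le> R n"
        proof -
          show "integrable M (V n)"
            unfolding V_def by (rule perturbation_expectation[OF noise \<rho> dq n]) simp
          have "expectation (V n) \<le> 48 * \<sigma>\<^sup>2 * (n / d n + 1) + 48 * \<sigma>\<^sup>2 * (n / q n + 1)
              + (real ?p + 2) * (2 * real (q n) * \<sigma>\<^sup>2) + C\<^sup>2 / n * (n * D)"
            unfolding V_def D_def by (rule perturbation_expectation[OF noise \<rho> dq n]) simp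
          also have "\<dots> = R n" using n by (simp add: R_def d_def q_def)
          finally show "expectation (V n) \<le> R n" .
        qed
        have [measurable]: "\<rho>_bar n \<in> borel_measurable M" "V n \<in> borel_measurable M"
          using \<rho>_bar_meas[OF n] V(1) by auto
        let ?A = "{\<omega> \<in> space M. C * real n powr (-1/2) < \<bar>\<rho>_bar n \<omega> - \<rho>\<bar>}"
        let ?B = "{\<omega> \<in> space M. n * \<beta> n / \<eta> \<le> V n \<omega>}"
        have \<eta>: "0 < \<eta>" by (simp add: \<eta>_def)
        have V_nonneg: "0 \<le> V n \<omega>" for \<omega>
        proof -
          have "0 \<le> T" unfolding T_def by (rule sum_nonneg) auto
          then show ?thesis unfolding V_def perturbation_def lag_energy_bound_def using \<rho>
            by (intro add_nonneg_nonneg mult_nonneg_nonneg divide_nonneg_nonneg block_energy_nonneg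
                near_energy_nonneg sum_nonneg) auto
        qed
        \<comment> \<open>A wrong selection forces a large estimation error of \<open>\<rho>_bar n\<close> or a large perturbation.\<close>
        have "?bad n \<subseteq> ?A \<union> ?B"
        proof
          fix \<omega> assume "\<omega> \<in> ?bad n"
          then have \<omega>: "\<omega> \<in> space M" "m_hat n \<omega> \<noteq> ?p" using \<open>0 < e\<close> by auto
          show "\<omega> \<in> ?A \<union> ?B"
          proof (rule ccontr)
            assume "\<omega> \<notin> ?A \<union> ?B"
            then have close: "\<bar>\<rho>_bar n \<omega> - \<rho>\<bar> \<le> C * real n powr (-1/2)"
              and small: "V n \<omega> < n * \<beta> n / \<eta>" using \<omega>(1) by auto
            have "(\<rho>_bar n \<omega> - \<rho>)\<^sup>2 \<le> (C * real n powr (-1/2))\<^sup>2"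
              using close by (metis abs_ge_zero power2_abs power_mono)
            also have "\<dots> = C\<^sup>2 * (real n powr (-1/2) * real n powr (-1/2))"
              by (simp add: power2_eq_square)
            also have "real n powr (-1/2) * real n powr (-1/2) = 1 / n"
              using n by (simp add: powr_add[symmetric] powr_minus_divide)
            finally have sq: "(\<rho>_bar n \<omega> - \<rho>)\<^sup>2 \<le> C\<^sup>2 / n" by simp
            have "(\<Sum>i=1..n. (z n (i - 1) \<omega>)\<^sup>2) \<le> lag_energy_bound \<rho> T n (z n 0 \<omega>) (\<lambda>i. \<epsilon> i \<omega>)"
              using lag_energy_le[where x = "\<lambda>i. z n i \<omega>" and \<epsilon> = "\<lambda>i. \<epsilon> i \<omega>" and \<theta> = \<theta>,
                  OF \<rho> s0 s1 s_model[OF n \<omega>(1)] T] .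
            then have "(\<rho>_bar n \<omega> - \<rho>)\<^sup>2 * (\<Sum>i=1..n. (z n (i - 1) \<omega>)\<^sup>2)
                \<le> C\<^sup>2 / n * lag_energy_bound \<rho> T n (z n 0 \<omega>) (\<lambda>i. \<epsilon> i \<omega>)"
              using sq by (intro mult_mono sum_nonneg) auto
            then have "block_energy (d n) n (\<lambda>i. \<epsilon> i \<omega>) + block_energy (q n) n (\<lambda>i. \<epsilon> i \<omega>)
                + near_energy (s n) ?p (q n) (\<lambda>i. \<epsilon> i \<omega>)
                + (\<rho>_bar n \<omega> - \<rho>)\<^sup>2 * (\<Sum>i=1..n. (z n (i - 1) \<omega>)\<^sup>2) \<le> V n \<omega>" (is "?W \<le> _")
              by (simp add: V_def perturbation_def)
            then have "\<eta> * ?W \<le> \<eta> * V n \<omega>" using \<eta> by (intro mult_left_mono) auto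
            also have "\<dots> < n * \<beta> n" using small \<eta> by (simp add: field_simps)
            finally have noise_small: "\<eta> * ?W < n * \<beta> n" .
            have "m_hat n \<omega> = ?p"
            proof (rule penalised_criterion_selects[where \<kappa> = \<kappa>])
              show "4 * (real m_max + 1) * (real ?p + 1) * (block_energy (nat \<lceil>\<Delta> n\<rceil>) n (\<lambda>i. \<epsilon> i \<omega>)
                  + block_energy (q n) n (\<lambda>i. \<epsilon> i \<omega>) + near_energy (s n) ?p (q n) (\<lambda>i. \<epsilon> i \<omega>)
                  + (\<rho>_bar n \<omega> - \<rho>)\<^sup>2 * (\<Sum>i=1..n. (z n (i - 1) \<omega>)\<^sup>2)) < n * \<beta> n"
                using noise_small unfolding \<eta>_def d_def .
              show "is_arg_min (\<lambda>m. SS \<Delta> n m (\<lambda>i. z n i \<omega>) (\<rho>_bar n \<omega>) / real n + \<beta> n * real m)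
                  (\<lambda>m. m \<le> m_max) (m_hat n \<omega>)"
                using m_hat[OF n _ \<omega>(1)] ne by blast
            qed (use n \<Delta> adm h ne signal \<kappa>(2) dq(2) \<beta>_pos[OF n] le_max s_model[OF n \<omega>(1)] in auto)
            then show False using \<omega>(2) by simp
          qed
        qed
        then have "prob (?bad n) \<le> prob (?A \<union> ?B)" by (rule finite_measure_mono) measurable
        also have "\<dots> \<le> prob ?A + prob ?B" by (rule measure_Un_le) measurable
        also have "prob ?B \<le> expectation (V n) / (n * \<beta> n / \<eta>)"
          using V(1) V_nonneg n \<beta>_pos[OF n] \<eta>
          by (intro integral_Markov_inequality_measure[where A = "space M"]) auto
        also have "\<dots> \<le> R n / (n * \<beta> n / \<eta>)"
          using V(2) n \<beta>_pos[OF n] \<eta> by (intro divide_right_mono) auto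
        also have "\<dots> = \<eta> * (R n / (n * \<beta> n))" by simp
        finally show ?case using elim(1,3) by linarith
      qed
    next
      fix a :: real assume "a < 0"
      then show "\<forall>\<^sub>F n in sequentially. a < prob (?bad n)"
        by (intro always_eventually allI) (metis measure_nonneg order_less_le_trans)
    qed
  qed
  then show ?thesis unfolding gaussian_noise_def by blast
qed

end
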